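(* Let $0<\gamma\ll 1$ and let $n$ be a sufficiently large integer with $n\equiv 0\pmod 3$; that is: there exists $\gamma_0>0$ such that for every real $\gamma$ with $0<\gamma<\gamma_0$ there exists $n_0=n_0(\gamma)$ such that the following holds for every integer $n\ge n_0$ with $n\equiv 0\pmod 3$. Let $H$ be a $3$-graph with vertex set $[n]$. If for every vertex $v\in V(H)$, \[ \rho(N_H(v))>(2/3+\gamma)\,n, \] then $H$ contains a perfect matching.
   Context: $[n]=\{1,\dots,n\}$. A $3$-graph $H$ is a $3$-uniform hypergraph: a vertex set $V(H)$ together with an edge set $E(H)\subseteq\binom{V(H)}{3}$, the family of $3$-element subsets of $V(H)$. For $v\in V(H)$, the link graph $N_H(v)$ is the simple graph with vertex set $V(H)\setminus\{v\}$ and edge set $\{e\subseteq V(H)\setminus\{v\}: e\cup\{v\}\in E(H)\}$ (its edges are $2$-sets). For a simple graph $G$, $\rho(G)$ denotes its spectral radius, i.e. the largest eigenvalue of its adjacency matrix. A matching in $H$ is a collection of pairwise disjoint edges of $H$; it is perfect if its edges cover every vertex of $H$. *)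

theory Defs
  imports "Jordan_Normal_Form.Spectral_Radius"
begin

text \<open>Graphs and hypergraphs are given as pairs (vertex set, edge set).\<close>

definition three_graph :: "'a set \<times> 'a set set \<Rightarrow> bool" where
  "three_graph H \<longleftrightarrow> snd H \<subseteq> {e. e \<subseteq> fst H \<and> card e = 3}"

definition link_graph :: "'a set \<times> 'a set set \<Rightarrow> 'a \<Rightarrow> 'a set \<times> 'a set set" where
  "link_graph H v = (fst H - {v}, {e. e \<subseteq> fst H - {v} \<and> e \<union> {v} \<in> snd H})"

text \<open>Rows and columns follow the increasing enumeration of the (finite) vertex set; the spectrum
  does not depend on this choice. The diagonal vanishes for simple graphs, whose edges
  are two-element sets.\<close>

definition adjacency_matrix :: "'a::linorder set \<times> 'a set set \<Rightarrow> real mat" where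
  "adjacency_matrix G =
     (let vs = sorted_list_of_set (fst G)
      in mat (card (fst G)) (card (fst G))
           (\<lambda>(i, j). if {vs ! i, vs ! j} \<in> snd G then 1 else 0))"

text \<open>The spectrum of a real matrix consists of its real eigenvalues, which are all of its
  eigenvalues for the symmetric matrices considered here. The maximum is meaningful only
  for graphs with a finite nonempty vertex set.\<close>

definition graph_spectral_radius :: "'a::linorder set \<times> 'a set set \<Rightarrow> real" where
  "graph_spectral_radius G = Max (spectrum (adjacency_matrix G))"

definition matching :: "'a set \<times> 'a set set \<Rightarrow> 'a set set \<Rightarrow> bool" where
  "matching H M \<longleftrightarrow> M \<subseteq> snd H \<and> pairwise disjnt M"

definition perfect_matching :: "'a set \<times> 'a set set \<Rightarrow> 'a set set \<Rightarrow> bool" where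
  "perfect_matching H M \<longleftrightarrow> matching H M \<and> \<Union> M = fst H"

end

theory Submission
  imports Defs "HOL-Library.Disjoint_Sets" "HOL-Library.FuncSet" "HOL-Real_Asymp.Real_Asymp"
begin

text \<open>Partition the vertices into triples so that the number of edges among them is maximal, and
  suppose that some triple \<open>P\<^sub>0\<close> is not an edge. Sample \<open>m\<close> triples of the partition at random, where
  \<open>m\<close> is a large constant. By a Chernoff bound, the edges meeting three different ones of the sampled
  triples and \<open>P\<^sub>0\<close> form, with probability at least one half, a 3-graph \<open>F\<close> on \<open>3 m + 3\<close> labels whose
  links still have approximate eigenvectors with eigenvalue above two thirds. By pigeonhole one such \<open>F\<close>
  has positive density among the tuples, and by Erdos' theorem on complete multipartite
  hypergraphs there are large disjoint families of triples all of whose transversals have type \<open>F\<close>.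

  It remains to find integral edge weights on \<open>F\<close> of degree 1 on the labels of \<open>P\<^sub>0\<close> and constant
  degree on the others: realised as a matching of the blow-up of \<open>F\<close>, they replace \<open>P\<^sub>0\<close> and
  some of the triples by edges only, contradicting maximality. Such weights exist because the
  all-ones vector lies in the interior of the cone spanned by the edges (Farkas; otherwise some
  link would have a fractional vertex cover of at most a third of the vertices, which the spectral
  radius forbids) and because the edges span the full lattice of vectors with coordinate sum
  divisible by 3 (dense links leave at most two classes of labels modulo the lattice, and with two
  classes some link would be bipartite or confined to one class).\<close>

subsection \<open>Rational linear programming\<close>

text \<open>The constant 2/3 is critical only for the cone. A third of the vertices joined to
  everything has a vertex cover of weight one third and, asymptotically, spectral radius exactly two
  thirds of the order. The lattice arguments have room to spare: they count walks of length 2, of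
  which there are more than 4/9 of the square of the order.

  The spectral radius of a random sublink is hard to control directly. The inequality A \<phi> \<ge>
  r \<phi> for a nonnegative vector \<phi> is not: each of its entries concerns a sum over
  independently chosen triples, so it survives sampling up to an additive error. This is why links
  of types are only asked to be \<open>rich\<close>.

  The other constraint is that an exchange must consume whole triples of the partition. So the
  vertices of a sampled triple must be used equally often, whence the constant degree, and
  \<open>p0\<close> exactly once. Whole triples are sampled for the same reason. The sample size
  depends on \<gamma> alone, so there are finitely many types and one bound on their weights, fixed
  before the hypergraph is given.\<close>

text \<open>Stated over any ordered field because it is applied over the rationals, so that the
  coefficients can be cleared of denominators. The proof is therefore algebraic: the generators are
  removed one at a time by projecting to the kernel of the one removed.\<close>

lemma farkas:
  fixes a :: "'i \<Rightarrow> 'b \<Rightarrow> 'k::linordered_field"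
  assumes "finite I" and "finite B"
    and "\<And>x. (\<forall>i\<in>I. 0 \<le> (\<Sum>b\<in>B. a i b * x b)) \<Longrightarrow> 0 \<le> (\<Sum>b\<in>B. \<beta> b * x b)"
  shows "\<exists>z. (\<forall>i\<in>I. 0 \<le> z i) \<and> (\<forall>b\<in>B. \<beta> b = (\<Sum>i\<in>I. z i * a i b))"
  using assms(1,3)
proof (induction I arbitrary: a \<beta> rule: finite_induct)
  case empty
  have "0 \<le> (\<Sum>b\<in>B. \<beta> b * (- \<beta> b))"
    by (rule empty.prems) simp
  hence "(\<Sum>b\<in>B. \<beta> b * \<beta> b) \<le> 0"
    by (simp add: sum_negf)
  moreover have "(\<Sum>b\<in>B. \<beta> b * \<beta> b) \<ge> 0"
    by (intro sum_nonneg) simp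
  ultimately have "(\<Sum>b\<in>B. \<beta> b * \<beta> b) = 0"
    by simp
  hence "\<forall>b\<in>B. \<beta> b = 0"
    using \<open>finite B\<close> by (subst (asm) sum_nonneg_eq_0_iff) auto
  thus ?case by simp
next
  case (insert i0 I)
  define dot where "dot f x = (\<Sum>b\<in>B. f b * x b)" for f x :: "'b \<Rightarrow> 'k"
  have dot_left: "dot (\<lambda>b. f b + c * g b) x = dot f x + c * dot g x" for f g c x
    by (simp add: dot_def sum_distrib_left sum.distrib algebra_simps)
  have dot_right: "dot f (\<lambda>b. x b + c * y b) = dot f x + c * dot f y" for f c x y
    by (simp add: dot_def sum_distrib_left sum.distrib algebra_simps)
  have dot_scale: "dot f (\<lambda>b. c * y b) = c * dot f y" for f c y
    by (simp add: dot_def sum_distrib_left algebra_simps)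
  have prem: "0 \<le> dot \<beta> x" if "0 \<le> dot (a i0) x" "\<And>i. i \<in> I \<Longrightarrow> 0 \<le> dot (a i) x" for x
    using insert.prems[of x] that unfolding dot_def by auto
  show ?case
  proof (cases "\<forall>x. (\<forall>i\<in>I. 0 \<le> dot (a i) x) \<longrightarrow> 0 \<le> dot \<beta> x")
    case True
    then obtain z where z: "\<forall>i\<in>I. 0 \<le> z i" "\<forall>b\<in>B. \<beta> b = (\<Sum>i\<in>I. z i * a i b)"
      using insert.IH[of a \<beta>] unfolding dot_def by auto
    have "(\<Sum>i\<in>I. (z(i0 := 0)) i * a i b) = (\<Sum>i\<in>I. z i * a i b)" for b
      using insert.hyps by (intro sum.cong) auto
    hence "\<forall>b\<in>B. \<beta> b = (\<Sum>i\<in>insert i0 I. (z(i0 := 0)) i * a i b)"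
      using z(2) insert.hyps by simp
    thus ?thesis
      using z(1) by (intro exI[of _ "z(i0 := 0)"]) auto
  next
    case False
    then obtain y where y: "\<And>i. i \<in> I \<Longrightarrow> 0 \<le> dot (a i) y" "dot \<beta> y < 0"
      by (auto simp: not_le)
    have neg: "dot (a i0) y < 0"
      using prem[of y] y by force
    \<comment> \<open>Normalised so that \<open>a i0\<close> takes the value -1 at
      \<open>x0\<close>. Adding to x the multiple \<open>dot (a i0) x\<close> of \<open>x0\<close>
      projects x to the kernel of \<open>a i0\<close>, and \<open>a'\<close> and
      \<open>\<beta>'\<close> are \<open>a\<close> and \<open>\<beta>\<close> composed with this
      projection.\<close>
    define x0 where "x0 = (\<lambda>b. (1 / - dot (a i0) y) * y b)"
    have x0: "dot (a i0) x0 = -1" "dot \<beta> x0 < 0" "\<And>i. i \<in> I \<Longrightarrow> 0 \<le> dot (a i) x0"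
      using neg y unfolding x0_def dot_scale
      by (auto simp: field_simps divide_nonneg_neg divide_nonpos_neg mult_nonneg_nonpos)
    define a' where "a' i = (\<lambda>b. a i b + dot (a i) x0 * a i0 b)" for i
    define \<beta>' where "\<beta>' = (\<lambda>b. \<beta> b + dot \<beta> x0 * a i0 b)"
    have "0 \<le> dot \<beta>' x" if x: "\<forall>i\<in>I. 0 \<le> dot (a' i) x" for x
    proof -
      let ?x = "\<lambda>b. x b + dot (a i0) x * x0 b"
      have "0 \<le> dot \<beta> ?x"
      proof (rule prem)
        show "0 \<le> dot (a i0) ?x" by (simp add: dot_right x0)
        show "0 \<le> dot (a i) ?x" if "i \<in> I" for i
          using x[rule_format, OF that]
          unfolding dot_right a'_def dot_left by (simp add: mult.commute)
      qed
      thus ?thesis unfolding dot_right \<beta>'_def dot_left by (simp add: mult.commute)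
    qed
    then obtain z where z: "\<forall>i\<in>I. 0 \<le> z i" "\<forall>b\<in>B. \<beta>' b = (\<Sum>i\<in>I. z i * a' i b)"
      using insert.IH[of a' \<beta>'] unfolding dot_def by auto
    define c where "c = (\<Sum>i\<in>I. z i * dot (a i) x0) - dot \<beta> x0"
    have "0 \<le> (\<Sum>i\<in>I. z i * dot (a i) x0)"
      using z x0 by (intro sum_nonneg) auto
    hence "0 \<le> c" using x0 unfolding c_def by linarith
    have eq: "\<beta> b = (\<Sum>i\<in>I. z i * a i b) + c * a i0 b" if "b \<in> B" for b
      using z(2)[rule_format, OF that]
      by (simp add: a'_def \<beta>'_def c_def algebra_simps sum.distrib sum_distrib_left sum_distrib_right)
    have "(\<Sum>i\<in>I. (z(i0 := c)) i * a i b) = (\<Sum>i\<in>I. z i * a i b)" for b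
      using insert.hyps by (intro sum.cong) auto
    hence "\<forall>b\<in>B. \<beta> b = (\<Sum>i\<in>insert i0 I. (z(i0 := c)) i * a i b)"
      using eq insert.hyps by simp
    thus ?thesis
      using z(1) \<open>0 \<le> c\<close> by (intro exI[of _ "z(i0 := c)"]) auto
  qed
qed

subsection \<open>Graphs of large spectral radius\<close>

text \<open>Threshold rounding. For 0 < \<theta> \<le> 1/2, the mean of the indicators of w \<ge>
  \<theta> and w \<ge> 1 - \<theta> is again a cover: if w i < 1 - \<theta>, then every neighbour j
  has w j > \<theta>. For uniform \<theta> its expectation is at most w; averaging over a finite
  grid instead costs the error \<epsilon>.\<close>

lemma half_integral_cover:
  fixes w :: "'l \<Rightarrow> real" and R :: "'l \<Rightarrow> 'l \<Rightarrow> bool"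
  assumes fin: "finite \<Lambda>" and w0: "\<And>i. i \<in> \<Lambda> \<Longrightarrow> 0 \<le> w i"
    and cover: "\<And>i j. i \<in> \<Lambda> \<Longrightarrow> j \<in> \<Lambda> \<Longrightarrow> R i j \<Longrightarrow> 1 \<le> w i + w j"
    and "0 < \<epsilon>"
  obtains W :: "'l \<Rightarrow> real" where "\<And>i. W i \<in> {0, 1/2, 1}"
    and "\<And>i j. i \<in> \<Lambda> \<Longrightarrow> j \<in> \<Lambda> \<Longrightarrow> R i j \<Longrightarrow> 1 \<le> W i + W j"
    and "sum W \<Lambda> \<le> sum w \<Lambda> + \<epsilon> * real (card \<Lambda>)"
proof -
  obtain N :: nat where N: "1 / \<epsilon> < real N"
    using reals_Archimedean2 by blast
  have "0 < 1 / \<epsilon>" using \<open>0 < \<epsilon>\<close> by simp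
  hence "0 < real N" using N by linarith
  hence N0: "N > 0" by simp
  \<comment> \<open>The midpoints of N equal subintervals of [0, 1/2]. Since
    \<open>1 - \<theta> k = \<theta> (2*N+1-k)\<close>, both indicators together run through the 2 N
    midpoints of [0, 1].\<close>
  define \<theta> where "\<theta> k = (2 * real k - 1) / (4 * real N)" for k
  define W where "W k i = (of_bool (\<theta> k \<le> w i) + of_bool (1 - \<theta> k \<le> w i)) / (2::real)" for k i
  have vals: "W k i \<in> {0, 1/2, 1}" for k i
    by (simp add: W_def of_bool_def)
  have \<theta>: "0 < \<theta> k \<and> \<theta> k \<le> 1/2" if "k \<in> {1..N}" for k
    using that by (auto simp: \<theta>_def field_simps)
  have W_cover: "1 \<le> W k i + W k j" if "k \<in> {1..N}" "i \<in> \<Lambda>" "j \<in> \<Lambda>" "R i j" for k i j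
    using cover[OF that(2-4)] \<theta>[OF that(1)] by (auto simp: W_def of_bool_def)
  have count: "(\<Sum>k\<in>{1..N}. W k i) \<le> real N * w i + 1/4" if i: "i \<in> \<Lambda>" for i
  proof -
    have "(\<Sum>k\<in>{1..N}. of_bool (1 - \<theta> k \<le> w i)) = (\<Sum>k\<in>{N+1..2*N}. of_bool (\<theta> k \<le> w i) :: real)"
      using N0 by (intro sum.reindex_bij_witness[of _ "\<lambda>k. 2*N+1-k" "\<lambda>k. 2*N+1-k"])
        (auto simp: \<theta>_def field_simps of_nat_diff)
    hence "2 * (\<Sum>k\<in>{1..N}. W k i) =
        (\<Sum>k\<in>{1..N}. of_bool (\<theta> k \<le> w i)) + (\<Sum>k\<in>{N+1..2*N}. of_bool (\<theta> k \<le> w i))"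
      by (simp add: W_def sum.distrib flip: sum_divide_distrib)
    also have "\<dots> = (\<Sum>k\<in>{1..2*N}. of_bool (\<theta> k \<le> w i))"
    proof -
      have "{1..2*N} = {1..N} \<union> {N+1..2*N}" by auto
      thus ?thesis by (simp add: sum.union_disjoint del: sum_of_bool_eq)
    qed
    also have "\<dots> = real (card {k\<in>{1..2*N}. \<theta> k \<le> w i})"
      by (simp add: of_bool_def sum.If_cases Int_def)
    also have "\<dots> \<le> real (card {1..nat \<lfloor>2 * real N * w i + 1/2\<rfloor>})"
    proof (intro of_nat_mono card_mono subsetI)
      fix k assume "k \<in> {k\<in>{1..2*N}. \<theta> k \<le> w i}"
      hence k: "1 \<le> k" "real k \<le> 2 * real N * w i + 1/2"
        using N0 by (auto simp: \<theta>_def field_simps)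
      thus "k \<in> {1..nat \<lfloor>2 * real N * w i + 1/2\<rfloor>}"
        by (simp add: le_nat_floor)
    qed auto
    also have "\<dots> \<le> 2 * real N * w i + 1/2"
      using w0[OF i] by simp
    finally show ?thesis by simp
  qed
  have "\<exists>k\<in>{1..N}. sum (W k) \<Lambda> \<le> sum w \<Lambda> + \<epsilon> * real (card \<Lambda>)"
  proof (rule ccontr)
    assume "\<not> ?thesis"
    hence "real (card {1..N}) * (sum w \<Lambda> + \<epsilon> * real (card \<Lambda>)) \<le> (\<Sum>k\<in>{1..N}. sum (W k) \<Lambda>)"
      by (intro sum_bounded_below) (auto simp: not_le less_imp_le)
    moreover have "(\<Sum>k\<in>{1..N}. sum (W k) \<Lambda>) \<le> (\<Sum>i\<in>\<Lambda>. real N * w i + 1/4)"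
      by (subst sum.swap) (intro sum_mono count)
    moreover have "(\<Sum>i\<in>\<Lambda>. real N * w i + 1/4) = real N * sum w \<Lambda> + card \<Lambda> / 4"
      by (simp add: sum.distrib sum_distrib_left)
    ultimately have "real N * \<epsilon> * real (card \<Lambda>) \<le> card \<Lambda> / 4"
      by (simp add: algebra_simps)
    moreover have "1 < real N * \<epsilon>"
      using N \<open>0 < \<epsilon>\<close> by (simp add: field_simps)
    moreover have "1 * real (card \<Lambda>) \<le> real N * \<epsilon> * card \<Lambda>"
      using calculation(2) by (intro mult_right_mono) auto
    ultimately have "card \<Lambda> = 0" by simp
    hence "\<Lambda> = {}" using fin by simp
    with \<open>\<not> ?thesis\<close> N0 show False by auto
  qed
  thus ?thesis
    using that vals W_cover by blast
qed

text \<open>A robust form of the statement that the link of v on \<Lambda> has spectral radius above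
  2/3 + \<gamma> times the order: \<phi> is a subeigenvector up to an additive error, which absorbs
  the sampling deviations. The lower bound on its sum excludes the zero vector. The vertex v may lie
  outside \<Lambda>.\<close>

definition rich :: "real \<Rightarrow> 'l set \<Rightarrow> 'l set set \<Rightarrow> 'l \<Rightarrow> bool" where
  "rich \<gamma> \<Lambda> F v \<longleftrightarrow> (\<exists>\<phi>. (\<forall>i\<in>\<Lambda>. 0 \<le> \<phi> i) \<and> (1 - \<gamma>/100) * real (card \<Lambda>) \<le> sum \<phi> \<Lambda> \<and>
     (\<forall>i\<in>\<Lambda>. (2/3 + \<gamma>) * real (card \<Lambda>) * \<phi> i - \<gamma>/100 * real (card \<Lambda>)
        \<le> sum \<phi> {j\<in>\<Lambda>. {v, i, j} \<in> F}))"

text \<open>The eigenvalue inequality is applied twice, first at a vertex where \<phi> attains its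
  maximum M and then at its neighbours, where \<phi> is finally bounded by M. Two steps are taken
  because degrees alone do not tell a bipartite link from others, whereas a bipartite graph has at
  most a quarter of the square of its order as walks of length 2 from a vertex.\<close>

lemma rich_walks:
  assumes "rich \<gamma> \<Lambda> F v" and fin: "finite \<Lambda>" "\<Lambda> \<noteq> {}" and \<gamma>: "0 < \<gamma>" "\<gamma> < 1/3"
  shows "\<exists>i\<in>\<Lambda>. 4/9 * (real (card \<Lambda>))\<^sup>2
    < (\<Sum>j\<in>{j\<in>\<Lambda>. {v, i, j} \<in> F}. real (card {k\<in>\<Lambda>. {v, j, k} \<in> F}))"
proof -
  obtain \<phi> where \<phi>0: "\<And>i. i \<in> \<Lambda> \<Longrightarrow> 0 \<le> \<phi> i"
    and \<phi>sum: "(1 - \<gamma>/100) * real (card \<Lambda>) \<le> sum \<phi> \<Lambda>"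
    and \<phi>: "\<And>i. i \<in> \<Lambda> \<Longrightarrow> (2/3 + \<gamma>) * real (card \<Lambda>) * \<phi> i - \<gamma>/100 * real (card \<Lambda>)
        \<le> sum \<phi> {j\<in>\<Lambda>. {v, i, j} \<in> F}"
    using assms(1) unfolding rich_def by blast
  define N where "N i = {j\<in>\<Lambda>. {v, i, j} \<in> F}" for i
  define t where "t = real (card \<Lambda>)"
  have t: "0 < t" using fin by (simp add: t_def card_gt_0_iff)
  have "Max (\<phi> ` \<Lambda>) \<in> \<phi> ` \<Lambda>" using fin by (intro Max_in) auto
  then obtain i where i: "i \<in> \<Lambda>" "\<phi> i = Max (\<phi> ` \<Lambda>)" by force
  hence max: "\<phi> j \<le> \<phi> i" if "j \<in> \<Lambda>" for j using fin that by simp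
  define M where "M = \<phi> i"
  have "sum \<phi> \<Lambda> \<le> t * M"
    using sum_bounded_above[of \<Lambda> \<phi> M] max by (simp add: t_def M_def)
  hence "(1 - \<gamma>/100) * t \<le> M * t" using \<phi>sum by (simp add: t_def mult.commute)
  hence M: "1 - \<gamma>/100 \<le> M" using t by simp
  have deg: "(2/3 + \<gamma>) * t * \<phi> j - \<gamma>/100 * t \<le> M * real (card (N j))" if "j \<in> \<Lambda>" for j
  proof -
    have "sum \<phi> (N j) \<le> real (card (N j)) * M"
      using max by (intro sum_bounded_above) (auto simp: N_def M_def)
    thus ?thesis using \<phi>[OF that] by (simp add: N_def t_def mult.commute)
  qed
  have N_le: "card (N i) \<le> t"
    unfolding t_def N_def using fin by (auto intro!: card_mono)
  \<comment> \<open>The gain over 4/9 is at least \<gamma> M > \<gamma>/2, while the additive errors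
    of the two steps cost at most \<gamma>/50.\<close>
  have "M * (4/9 * t\<^sup>2) < t\<^sup>2 * ((2/3 + \<gamma>)\<^sup>2 * M - (2/3 + \<gamma>) * (\<gamma>/100) - \<gamma>/100)"
  proof -
    have "\<gamma> * M \<le> (4/3 * \<gamma> + \<gamma>\<^sup>2) * M"
      using M \<gamma> by (intro mult_right_mono) (auto simp: add_increasing2)
    moreover have "\<gamma> * (1/2) \<le> \<gamma> * M" using M \<gamma> by (intro mult_left_mono) auto
    moreover have "(2/3 + \<gamma>) * (\<gamma>/100) \<le> 1 * (\<gamma>/100)"
      using \<gamma> by (intro mult_right_mono) auto
    ultimately have "(2/3 + \<gamma>) * (\<gamma>/100) + \<gamma>/100 < (4/3 * \<gamma> + \<gamma>\<^sup>2) * M"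
      using \<gamma> by linarith
    hence "M * (4/9) < (2/3 + \<gamma>)\<^sup>2 * M - (2/3 + \<gamma>) * (\<gamma>/100) - \<gamma>/100"
      by (simp add: power2_eq_square algebra_simps)
    thus ?thesis using t by (simp add: mult.left_commute)
  qed
  also have "\<dots> = (2/3 + \<gamma>) * t * ((2/3 + \<gamma>) * t * M - \<gamma>/100 * t) - \<gamma>/100 * t * t"
    by (simp add: power2_eq_square algebra_simps)
  also have "\<dots> \<le> (2/3 + \<gamma>) * t * sum \<phi> (N i) - \<gamma>/100 * t * real (card (N i))"
    using \<phi>[OF i(1)] N_le \<gamma> t
    by (intro diff_mono mult_left_mono) (auto simp: N_def M_def t_def)
  also have "\<dots> = (\<Sum>j\<in>N i. (2/3 + \<gamma>) * t * \<phi> j - \<gamma>/100 * t)"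
    by (simp add: sum_subtractf sum_distrib_left)
  also have "\<dots> \<le> (\<Sum>j\<in>N i. M * real (card (N j)))"
    by (intro sum_mono deg) (auto simp: N_def)
  also have "\<dots> = M * (\<Sum>j\<in>N i. real (card (N j)))"
    by (simp add: sum_distrib_left)
  finally have "4/9 * t\<^sup>2 < (\<Sum>j\<in>N i. real (card (N j)))"
    using M \<gamma> by (simp add: mult_less_cancel_left)
  thus ?thesis using i unfolding N_def t_def by blast
qed

text \<open>Testing the approximate eigenvector against \<open>1 + W\<close>, where \<open>W\<close> is a half-integral cover,
  shows that a cover of weight at most one third of the vertices forces a spectral radius of at
  most two thirds of them.\<close>

lemma rich_cover:
  fixes w :: "'l \<Rightarrow> real"
  assumes "rich \<gamma> \<Lambda> F v" and fin: "finite \<Lambda>" "\<Lambda> \<noteq> {}" and \<gamma>: "0 < \<gamma>" "\<gamma> < 1/3"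
    and w0: "\<And>i. i \<in> \<Lambda> \<Longrightarrow> 0 \<le> w i"
    and cover: "\<And>i j. i \<in> \<Lambda> \<Longrightarrow> j \<in> \<Lambda> \<Longrightarrow> {v, i, j} \<in> F \<Longrightarrow> 1 \<le> w i + w j"
  shows "real (card \<Lambda>) / 3 < sum w \<Lambda>"
proof (rule ccontr)
  assume "\<not> ?thesis"
  hence small: "sum w \<Lambda> \<le> real (card \<Lambda>) / 3" by simp
  obtain \<phi> where \<phi>0: "\<And>i. i \<in> \<Lambda> \<Longrightarrow> 0 \<le> \<phi> i"
    and \<phi>sum: "(1 - \<gamma>/100) * real (card \<Lambda>) \<le> sum \<phi> \<Lambda>"
    and \<phi>: "\<And>i. i \<in> \<Lambda> \<Longrightarrow> (2/3 + \<gamma>) * real (card \<Lambda>) * \<phi> i - \<gamma>/100 * real (card \<Lambda>)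
        \<le> sum \<phi> {j\<in>\<Lambda>. {v, i, j} \<in> F}"
    using assms(1) unfolding rich_def by blast
  define N where "N i = {j\<in>\<Lambda>. {v, i, j} \<in> F}" for i
  define t where "t = real (card \<Lambda>)"
  have t: "0 < t" using fin by (simp add: t_def card_gt_0_iff)
  obtain W :: "'l \<Rightarrow> real" where W: "\<And>i. W i \<in> {0, 1/2, 1}"
    and Wcover: "\<And>i j. i \<in> \<Lambda> \<Longrightarrow> j \<in> \<Lambda> \<Longrightarrow> {v, i, j} \<in> F \<Longrightarrow> 1 \<le> W i + W j"
    and Wsum: "sum W \<Lambda> \<le> sum w \<Lambda> + \<gamma>/4 * real (card \<Lambda>)"
    using half_integral_cover[of \<Lambda> w "\<lambda>i j. {v, i, j} \<in> F" "\<gamma>/4"] fin w0 cover \<gamma> by auto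
  define \<sigma> where "\<sigma> = sum W \<Lambda>"
  have \<sigma>: "\<sigma> \<le> (1/3 + \<gamma>/4) * t"
    using Wsum small by (simp add: \<sigma>_def t_def algebra_simps)
  have W01: "0 \<le> W i" "W i \<le> 1" for i using W[of i] by auto
  \<comment> \<open>Exactly twice the bound \<open>1/3 + \<gamma>/4\<close> on the density of the
    cover; the other half of the surplus \<gamma> has to beat the additive error.\<close>
  define \<mu> where "\<mu> = 2/3 + \<gamma>/2"
  \<comment> \<open>\<open>1 + W\<close> is a supereigenvector for \<open>\<mu> * t\<close>. When W
    is the indicator of a third of the vertices joined to everything, it is essentially the Perron
    vector. The estimate can fail at values strictly between 1/2 and 1, which is why the cover was
    rounded: a neighbour i has \<open>1 + W i\<close> at most 2 W i if \<open>W j = 0\<close> and at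
    most 3 W i if \<open>W j = 1/2\<close>.\<close>
  have bound: "(\<Sum>i\<in>N j. 1 + W i) \<le> \<mu> * t * (1 + W j)" if j: "j \<in> \<Lambda>" for j
  proof -
    have Nj: "1 \<le> W i + W j" if "i \<in> N j" for i
      using that j Wcover[of j i] by (auto simp: N_def)
    have sub: "sum W (N j) \<le> \<sigma>" unfolding \<sigma>_def using fin W01
      by (intro sum_mono2) (auto simp: N_def)
    have two: "2 * \<sigma> \<le> \<mu> * t" using \<sigma> by (simp add: \<mu>_def algebra_simps)
    consider "W j = 0" | "W j = 1/2" | "W j = 1" using W[of j] by blast
    thus ?thesis
    proof cases
      case 1
      have "(\<Sum>i\<in>N j. 1 + W i) \<le> (\<Sum>i\<in>N j. 2 * W i)"
        using Nj 1 W01 by (intro sum_mono) fastforce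
      also have "\<dots> \<le> 2 * \<sigma>" using sub by (simp flip: sum_distrib_left)
      finally show ?thesis using 1 two by simp
    next
      case 2
      have "(\<Sum>i\<in>N j. 1 + W i) \<le> (\<Sum>i\<in>N j. 3 * W i)"
        using Nj 2 W01 by (intro sum_mono) fastforce
      also have "\<dots> \<le> 3 * \<sigma>" using sub by (simp flip: sum_distrib_left)
      also have "\<dots> \<le> \<mu> * t * (1 + W j)" using two unfolding 2 by simp
      finally show ?thesis .
    next
      case 3
      have "real (card (N j)) \<le> t"
        unfolding t_def N_def using fin by (auto intro!: card_mono)
      hence "(\<Sum>i\<in>N j. 1 + W i) \<le> t + \<sigma>"
        using sub by (simp add: sum.distrib)
      also have "\<dots> \<le> 2 * (\<mu> * t)"
      proof -
        have "0 \<le> \<gamma> * t" using \<gamma> t by simp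
        thus ?thesis using \<sigma> t by (simp add: \<mu>_def algebra_simps)
      qed
      finally show ?thesis using 3 by simp
    qed
  qed
  have sym: "j \<in> N i \<and> i \<in> \<Lambda> \<longleftrightarrow> i \<in> N j \<and> j \<in> \<Lambda>" for i j
    by (auto simp: N_def insert_commute)
  define S where "S = (\<Sum>i\<in>\<Lambda>. (1 + W i) * \<phi> i)"
  have "(\<Sum>i\<in>\<Lambda>. (1 + W i) * ((2/3 + \<gamma>) * t * \<phi> i - \<gamma>/100 * t)) \<le> (\<Sum>i\<in>\<Lambda>. (1 + W i) * sum \<phi> (N i))"
    using \<phi> W01 by (intro sum_mono mult_left_mono) (auto simp: N_def t_def add_nonneg_nonneg)
  also have "\<dots> = (\<Sum>i\<in>\<Lambda>. \<Sum>j\<in>\<Lambda>. if j \<in> N i then (1 + W i) * \<phi> j else 0)"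
    using fin by (intro sum.cong refl) (simp add: sum_distrib_left N_def flip: sum.inter_filter)
  also have "\<dots> = (\<Sum>j\<in>\<Lambda>. \<Sum>i\<in>\<Lambda>. if j \<in> N i then (1 + W i) * \<phi> j else 0)"
    by (rule sum.swap)
  also have "\<dots> = (\<Sum>j\<in>\<Lambda>. \<phi> j * (\<Sum>i\<in>N j. 1 + W i))"
  proof (intro sum.cong refl)
    fix j assume j: "j \<in> \<Lambda>"
    have "(\<Sum>i\<in>\<Lambda>. if j \<in> N i then (1 + W i) * \<phi> j else 0) = (\<Sum>i\<in>{i\<in>\<Lambda>. j \<in> N i}. (1 + W i) * \<phi> j)"
      using fin by (simp flip: sum.inter_filter)
    also have "{i\<in>\<Lambda>. j \<in> N i} = N j" using sym j by (auto simp: N_def)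
    finally show "(\<Sum>i\<in>\<Lambda>. if j \<in> N i then (1 + W i) * \<phi> j else 0) = \<phi> j * (\<Sum>i\<in>N j. 1 + W i)"
      by (subst sum_distrib_left) (simp add: mult.commute)
  qed
  also have "\<dots> \<le> (\<Sum>j\<in>\<Lambda>. \<phi> j * (\<mu> * t * (1 + W j)))"
    using bound \<phi>0 by (intro sum_mono mult_left_mono) auto
  also have "\<dots> = \<mu> * t * S"
    by (simp add: S_def sum_distrib_left algebra_simps)
  finally have 1: "(\<Sum>i\<in>\<Lambda>. (1 + W i) * ((2/3 + \<gamma>) * t * \<phi> i - \<gamma>/100 * t)) \<le> \<mu> * t * S" .
  define Y where "Y = (\<Sum>i\<in>\<Lambda>. 1 + W i)"
  have "(\<Sum>i\<in>\<Lambda>. (1 + W i) * ((2/3 + \<gamma>) * t * \<phi> i - \<gamma>/100 * t)) =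
      (\<Sum>i\<in>\<Lambda>. (2/3 + \<gamma>) * t * ((1 + W i) * \<phi> i) - \<gamma>/100 * t * (1 + W i))"
    by (intro sum.cong) (auto simp: algebra_simps)
  also have "\<dots> = (2/3 + \<gamma>) * t * S - \<gamma>/100 * t * Y"
    unfolding S_def Y_def sum_distrib_left by (rule sum_subtractf)
  finally have "(2/3 + \<gamma>) * t * S - \<gamma>/100 * t * Y \<le> \<mu> * t * S"
    using 1 by simp
  moreover have "Y \<le> 2 * t"
    using sum_mono[of \<Lambda> "\<lambda>i. 1 + W i" "\<lambda>_. 2"] W01 by (simp add: Y_def t_def mult.commute)
  hence "\<gamma>/100 * t * Y \<le> \<gamma>/100 * t * (2 * t)"
    using t \<gamma> by (intro mult_left_mono) auto
  ultimately have "\<gamma> / 2 * t * S \<le> \<gamma>/2 * t * (1/25 * t)"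
    by (simp add: \<mu>_def algebra_simps)
  hence "S \<le> 1/25 * t" using \<gamma> t by simp
  moreover have "sum \<phi> \<Lambda> \<le> S" unfolding S_def
    using \<phi>0 W01 by (intro sum_mono) (simp add: algebra_simps)
  moreover have "(1 - \<gamma>/100) * t > 1/25 * t"
    using \<gamma> t by (intro mult_strict_right_mono) auto
  ultimately show False using \<phi>sum t by (simp add: t_def)
qed

subsection \<open>Integral matchings of a dense type\<close>

text \<open>\<open>U\<close> stands for the labels of the triple to be repaired. Richness is
  measured inside \<Lambda> for its vertices too, so each of them lies in an edge whose other two
  vertices are in \<Lambda>.\<close>

locale rich_system =
  fixes \<gamma> :: real and \<Lambda> U :: "'l set" and F :: "'l set set"
  assumes \<gamma>: "0 < \<gamma>" "\<gamma> < 1/3"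
    and fin: "finite \<Lambda>" "finite U" and nonempty: "\<Lambda> \<noteq> {}" and disj: "\<Lambda> \<inter> U = {}"
    and edge: "\<And>e. e \<in> F \<Longrightarrow> e \<subseteq> \<Lambda> \<union> U \<and> card e = 3"
    and rich: "\<And>v. v \<in> \<Lambda> \<union> U \<Longrightarrow> rich \<gamma> \<Lambda> F v"
    and dvd3: "3 dvd card \<Lambda>" "3 dvd card U"
begin

definition FL where "FL = {e \<in> F. e \<subseteq> \<Lambda>}"

definition nbh where "nbh v i = {j\<in>\<Lambda>. {v, i, j} \<in> F}"

lemma finF: "finite F"
proof (rule finite_subset)
  show "F \<subseteq> Pow (\<Lambda> \<union> U)" using edge by blast
qed (use fin in simp)

lemma finFL: "finite FL"
  unfolding FL_def using finF by simp

lemma FL_edge: "e \<in> FL \<Longrightarrow> e \<subseteq> \<Lambda> \<and> card e = 3 \<and> finite e"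
  unfolding FL_def using edge card_ge_0_finite[of e] by auto

lemma card_pos: "0 < card \<Lambda>"
  using fin nonempty by (simp add: card_gt_0_iff)

lemma distinct3: "{x, y, z} \<in> F \<Longrightarrow> x \<noteq> y \<and> x \<noteq> z \<and> y \<noteq> z"
  using edge[of "{x, y, z}"] by (auto simp: card_insert_if split: if_splits)

lemma fin_nbh: "finite (nbh v i)"
  unfolding nbh_def using fin by simp

lemma nbh_FL: "v \<in> \<Lambda> \<Longrightarrow> i \<in> \<Lambda> \<Longrightarrow> j \<in> nbh v i \<Longrightarrow> {v, i, j} \<in> FL"
  by (auto simp: nbh_def FL_def)

lemma walks:
  assumes "v \<in> \<Lambda> \<union> U"
  obtains i where "i \<in> \<Lambda>" "4/9 * (real (card \<Lambda>))\<^sup>2 < (\<Sum>j\<in>nbh v i. real (card (nbh v j)))"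
  using rich_walks[OF rich[OF assms] fin(1) nonempty \<gamma>] unfolding nbh_def by blast

lemma edge_at:
  assumes "v \<in> \<Lambda> \<union> U"
  obtains i j where "i \<in> \<Lambda>" "j \<in> \<Lambda>" "{v, i, j} \<in> F"
proof -
  obtain i where i: "i \<in> \<Lambda>" "4/9 * (real (card \<Lambda>))\<^sup>2 < (\<Sum>j\<in>nbh v i. real (card (nbh v j)))"
    using walks[OF assms] .
  have "nbh v i \<noteq> {}"
  proof
    assume "nbh v i = {}"
    with i(2) have "(real (card \<Lambda>))\<^sup>2 < 0" by simp
    thus False by simp
  qed
  thus ?thesis using that i(1) unfolding nbh_def by blast
qed

text \<open>If the least weight \<open>w v\<close> is negative, then \<open>(w - w v) / (- 3 w v)\<close> is a fractional vertex
  cover of the link of \<open>v\<close>.\<close>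

lemma nonneg_weight:
  fixes w :: "'l \<Rightarrow> real"
  assumes w: "\<And>e. e \<in> FL \<Longrightarrow> 0 \<le> sum w e" and le: "sum w \<Lambda> \<le> 0" and x: "x \<in> \<Lambda>"
  shows "w x = 0"
proof -
  have "Min (w ` \<Lambda>) \<in> w ` \<Lambda>" using fin nonempty by (intro Min_in) auto
  then obtain v where v: "v \<in> \<Lambda>" "w v = Min (w ` \<Lambda>)" by force
  hence min: "w v \<le> w j" if "j \<in> \<Lambda>" for j using fin that by simp
  have "0 \<le> w v"
  proof (rule ccontr)
    assume "\<not> 0 \<le> w v"
    hence neg: "w v < 0" by simp
    define w' where "w' i = (w i - w v) / (- 3 * w v)" for i
    have "real (card \<Lambda>) / 3 < sum w' \<Lambda>"
    proof (rule rich_cover[OF _ fin(1) nonempty \<gamma>])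
      show "rich \<gamma> \<Lambda> F v" using rich v by blast
      show "0 \<le> w' i" if "i \<in> \<Lambda>" for i
        unfolding w'_def using min[OF that] neg by (intro divide_nonneg_nonneg) auto
      show "1 \<le> w' i + w' j" if "i \<in> \<Lambda>" "j \<in> \<Lambda>" "{v, i, j} \<in> F" for i j
      proof -
        have "{v, i, j} \<in> FL" using that v by (simp add: FL_def)
        hence "0 \<le> w v + w i + w j"
          using w distinct3[OF that(3)] by fastforce
        hence "1 \<le> (w i - w v + (w j - w v)) / (- 3 * w v)"
          using neg by (subst pos_le_divide_eq) auto
        thus ?thesis unfolding w'_def by (simp only: add_divide_distrib)
      qed
    qed
    also have "sum w' \<Lambda> = (sum w \<Lambda> - real (card \<Lambda>) * w v) / (- 3 * w v)"
      unfolding w'_def by (subst sum_divide_distrib[symmetric]) (simp add: sum_subtractf)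
    also have "\<dots> = real (card \<Lambda>) / 3 + sum w \<Lambda> / (- 3 * w v)"
      using neg by (simp add: field_simps)
    finally have "0 < sum w \<Lambda> / (- 3 * w v)" by simp
    moreover have "sum w \<Lambda> / (- 3 * w v) \<le> 0"
      using neg le by (intro divide_nonpos_pos) auto
    ultimately show False by linarith
  qed
  hence "0 \<le> w j" if "j \<in> \<Lambda>" for j using min[OF that] by linarith
  moreover from this have "sum w \<Lambda> = 0"
    using le sum_nonneg[of \<Lambda> w] by force
  ultimately show ?thesis using x fin by (simp add: sum_nonneg_eq_0_iff)
qed

text \<open>By \<open>nonneg_weight\<close> a weight that is nonnegative on all edges and has total
  at most 0 vanishes, so Farkas represents every vector by the edges and the negative all-ones
  vector. Choosing minus the sum of all edges as the target forces each edge to have coefficient at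
  least 1 in the resulting representation of a multiple of the all-ones vector.\<close>

lemma rational_interior:
  obtains s :: rat and z :: "'l set \<Rightarrow> rat" where "0 \<le> s" "\<And>e. e \<in> FL \<Longrightarrow> 0 \<le> z e"
    "\<And>x. x \<in> \<Lambda> \<Longrightarrow> s = (\<Sum>e\<in>FL. (1 + z e) * of_bool (x \<in> e))"
proof -
  define a :: "'l set option \<Rightarrow> 'l \<Rightarrow> rat" where
    "a i x = (case i of None \<Rightarrow> -1 | Some e \<Rightarrow> of_bool (x \<in> e))" for i x
  define \<beta> :: "'l \<Rightarrow> rat" where "\<beta> x = - (\<Sum>e\<in>FL. of_bool (x \<in> e))" for x
  have "\<exists>z. (\<forall>i\<in>insert None (Some ` FL). 0 \<le> z i) \<and>
      (\<forall>x\<in>\<Lambda>. \<beta> x = (\<Sum>i\<in>insert None (Some ` FL). z i * a i x))"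
  proof (rule farkas)
    fix w :: "'l \<Rightarrow> rat"
    assume w: "\<forall>i\<in>insert None (Some ` FL). 0 \<le> (\<Sum>x\<in>\<Lambda>. a i x * w x)"
    have ind: "(\<Sum>x\<in>\<Lambda>. of_bool (x \<in> e) * w x) = sum w e" if "e \<in> FL" for e
    proof -
      have "(\<Sum>x\<in>\<Lambda>. of_bool (x \<in> e) * w x) = (\<Sum>x\<in>\<Lambda>. if x \<in> e then w x else 0)"
        by (intro sum.cong) auto
      also have "\<dots> = sum w (\<Lambda> \<inter> e)" using fin by (simp add: sum.inter_restrict)
      also have "\<Lambda> \<inter> e = e" using FL_edge[OF that] by blast
      finally show ?thesis .
    qed
    have "of_rat (w x) = (0::real)" if "x \<in> \<Lambda>" for x
    proof (rule nonneg_weight[OF _ _ that])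
      fix e assume e: "e \<in> FL"
      hence "0 \<le> sum w e"
        using w ind[OF e] by (force simp: a_def)
      thus "0 \<le> (\<Sum>x\<in>e. of_rat (w x) :: real)"
        by (simp flip: of_rat_sum)
    next
      have "sum w \<Lambda> \<le> 0" using w by (simp add: a_def sum_negf)
      thus "(\<Sum>x\<in>\<Lambda>. of_rat (w x) :: real) \<le> 0" by (simp flip: of_rat_sum)
    qed
    thus "0 \<le> (\<Sum>x\<in>\<Lambda>. \<beta> x * w x)" by simp
  qed (use fin finFL in auto)
  then obtain z where z: "\<forall>i\<in>insert None (Some ` FL). 0 \<le> z i"
    "\<forall>x\<in>\<Lambda>. \<beta> x = (\<Sum>i\<in>insert None (Some ` FL). z i * a i x)" by blast
  show ?thesis
  proof (rule that)
    show "0 \<le> z None" "\<And>e. e \<in> FL \<Longrightarrow> 0 \<le> z (Some e)" using z(1) by auto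
    fix x assume "x \<in> \<Lambda>"
    hence "\<beta> x = - z None + (\<Sum>e\<in>FL. z (Some e) * of_bool (x \<in> e))"
      using z(2) finFL by (simp add: a_def sum.reindex inj_on_def del: sum_mult_of_bool_eq)
    thus "z None = (\<Sum>e\<in>FL. (1 + z (Some e)) * of_bool (x \<in> e))"
      by (simp add: \<beta>_def ring_distribs sum.distrib del: sum_mult_of_bool_eq sum_of_bool_eq)
  qed
qed

end

section \<open>From rational to integral weights\<close>

lemma common_denominator:
  fixes z :: "'i \<Rightarrow> rat"
  assumes "finite I"
  obtains K :: nat where "0 < K" "\<And>i. i \<in> I \<Longrightarrow> of_nat K * z i \<in> \<int>"
proof -
  have "\<exists>K::nat. 0 < K \<and> (\<forall>i\<in>I. of_nat K * z i \<in> \<int>)"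
    using assms
  proof induction
    case empty
    thus ?case by (auto intro: exI[of _ 1])
  next
    case (insert i I)
    then obtain K :: nat where K: "0 < K" "\<forall>i\<in>I. of_nat K * z i \<in> \<int>" by blast
    obtain a b where ab: "quotient_of (z i) = (a, b)" by fastforce
    have b: "b > 0" using quotient_of_denom_pos[OF ab] .
    have zi: "z i = of_int a / of_int b" using quotient_of_div[OF ab] .
    have "of_nat (K * nat b) * z i = of_int (int K * a)" using b zi by simp
    moreover have "of_nat (K * nat b) * z j = of_int b * (of_nat K * z j)" for j
      using b by simp
    ultimately show ?case using K b
      by (intro exI[of _ "K * nat b"]) (metis Ints_mult Ints_of_int insert_iff mult_pos_pos zero_less_nat_eq)
  qed
  thus ?thesis using that by blast
qed

context rich_system begin

lemma integer_interior:
  obtains S :: nat and q :: "'l set \<Rightarrow> nat" where "\<And>e. e \<in> FL \<Longrightarrow> 0 < q e"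
    "\<And>x. x \<in> \<Lambda> \<Longrightarrow> S = (\<Sum>e\<in>FL. q e * of_bool (x \<in> e))"
proof -
  obtain s :: rat and z :: "'l set \<Rightarrow> rat" where sz: "0 \<le> s" "\<And>e. e \<in> FL \<Longrightarrow> 0 \<le> z e"
    "\<And>x. x \<in> \<Lambda> \<Longrightarrow> s = (\<Sum>e\<in>FL. (1 + z e) * of_bool (x \<in> e))"
    using rational_interior by blast
  obtain K :: nat where K: "0 < K" "\<And>i. i \<in> insert None (Some ` FL) \<Longrightarrow>
      of_nat K * (case i of None \<Rightarrow> s | Some e \<Rightarrow> z e) \<in> \<int>"
    using common_denominator[of "insert None (Some ` FL)" "case_option s z"] finFL by blast
  have nn: "\<exists>k::nat. x = of_nat k" if "x \<in> \<int>" "0 \<le> x" for x :: rat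
    using that by (metis Ints_cases of_int_0_le_iff of_nat_nat)
  obtain S :: nat where S: "of_nat K * s = of_nat S"
    using nn[of "of_nat K * s"] K(2)[of None] sz(1) by auto
  have "\<forall>e\<in>FL. \<exists>k::nat. of_nat K * z e = of_nat k"
    using nn K(2)[of "Some _"] sz(2) by auto
  then obtain k :: "'l set \<Rightarrow> nat" where k: "\<And>e. e \<in> FL \<Longrightarrow> of_nat K * z e = of_nat (k e)"
    by metis
  show ?thesis
  proof (rule that)
    show "0 < K + k e" for e using K(1) by simp
    fix x assume x: "x \<in> \<Lambda>"
    have "rat_of_nat S = (\<Sum>e\<in>FL. of_nat K * ((1 + z e) * of_bool (x \<in> e)))"
      unfolding S[symmetric] sz(3)[OF x] sum_distrib_left ..
    also have "\<dots> = (\<Sum>e\<in>FL. of_nat ((K + k e) * of_bool (x \<in> e)))"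
      by (intro sum.cong refl) (simp add: ring_distribs flip: k)
    also have "\<dots> = of_nat (\<Sum>e\<in>FL. (K + k e) * of_bool (x \<in> e))"
      by simp
    finally show "S = (\<Sum>e\<in>FL. (K + k e) * of_bool (x \<in> e))"
      using of_nat_eq_iff by blast
  qed
qed

end

section \<open>The lattice spanned by the edges inside \<Lambda>\<close>

context rich_system begin

definition lat :: "('l \<Rightarrow> int) \<Rightarrow> bool" where
  "lat g \<longleftrightarrow> (\<exists>c. \<forall>x\<in>\<Lambda>. g x = (\<Sum>e\<in>FL. c e * of_bool (x \<in> e)))"

lemma lat_lincomb:
  assumes "lat f" "lat g"
  shows "lat (\<lambda>x. f x + k * g x)"
proof -
  obtain c d where "\<forall>x\<in>\<Lambda>. f x = (\<Sum>e\<in>FL. c e * of_bool (x \<in> e))"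
    "\<forall>x\<in>\<Lambda>. g x = (\<Sum>e\<in>FL. d e * of_bool (x \<in> e))"
    using assms unfolding lat_def by blast
  hence "\<forall>x\<in>\<Lambda>. f x + k * g x = (\<Sum>e\<in>FL. (c e + k * d e) * of_bool (x \<in> e))"
    by (simp add: ring_distribs sum.distrib sum_distrib_left mult.assoc del: sum_mult_of_bool_eq)
  thus ?thesis unfolding lat_def by (intro exI[of _ "\<lambda>e. c e + k * d e"])
qed

lemma lat_zero: "lat (\<lambda>x. 0)"
  unfolding lat_def by (intro exI[of _ "\<lambda>_. 0"]) simp

lemma lat_sum:
  assumes "finite A" "\<And>a. a \<in> A \<Longrightarrow> lat (f a)"
  shows "lat (\<lambda>x. \<Sum>a\<in>A. k a * f a x)"
  using assms
proof induction
  case (insert a A)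
  hence "lat (\<lambda>x. (\<Sum>a\<in>A. k a * f a x) + k a * f a x)" by (intro lat_lincomb) auto
  thus ?case using insert by (simp add: add.commute)
qed (simp add: lat_zero)

lemma lat_cong: "lat f \<Longrightarrow> (\<And>x. x \<in> \<Lambda> \<Longrightarrow> f x = g x) \<Longrightarrow> lat g"
  unfolding lat_def by auto

lemma lat_edge:
  assumes "e \<in> FL"
  shows "lat (\<lambda>x. of_bool (x \<in> e))"
  unfolding lat_def
proof (intro exI ballI)
  fix x
  have "(\<Sum>e'\<in>FL. of_bool (e' = e) * of_bool (x \<in> e')) = (\<Sum>e'\<in>FL. if e' = e then of_bool (x \<in> e') else 0 :: int)"
    by (intro sum.cong) auto
  thus "of_bool (x \<in> e) = (\<Sum>e'\<in>FL. of_bool (e' = e) * of_bool (x \<in> e') :: int)"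
    using assms finFL by simp
qed

definition cls :: "'l \<Rightarrow> 'l \<Rightarrow> bool" where
  "cls x y \<longleftrightarrow> lat (\<lambda>u. of_bool (u = x) - of_bool (u = y))"

lemma cls_refl: "cls x x"
  unfolding cls_def using lat_zero by simp

lemma cls_sym: "cls x y \<Longrightarrow> cls y x"
  unfolding cls_def using lat_lincomb[OF lat_zero, of _ "-1"] by fastforce

lemma cls_shared:
  assumes "{x, i, j} \<in> FL" "{y, i, j} \<in> FL"
  shows "cls x y"
  unfolding cls_def
proof (rule lat_cong[OF lat_lincomb[OF lat_edge[OF assms(1)] lat_edge[OF assms(2)], of "-1"]])
  fix u
  have "x \<noteq> i" "x \<noteq> j" "y \<noteq> i" "y \<noteq> j"
    using assms distinct3 unfolding FL_def by blast+
  thus "of_bool (u \<in> {x, i, j}) + - 1 * of_bool (u \<in> {y, i, j}) = (of_bool (u = x) - of_bool (u = y) :: int)"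
    by auto
qed

text \<open>Walks of length 2 from one vertex inject into the ordered edges of the link, by their
  second step. The bound 4/9 is weakened to 1/3, which is what makes three links overlap.\<close>

lemma link_density:
  assumes "v \<in> \<Lambda>"
  shows "(real (card \<Lambda>))\<^sup>2 < 3 * real (card {(i, j). i \<in> \<Lambda> \<and> j \<in> nbh v i})"
proof -
  obtain i where i: "i \<in> \<Lambda>" "4/9 * (real (card \<Lambda>))\<^sup>2 < (\<Sum>j\<in>nbh v i. real (card (nbh v j)))"
    using walks[of v] assms by blast
  have "(\<Sum>j\<in>nbh v i. real (card (nbh v j))) \<le> (\<Sum>j\<in>\<Lambda>. real (card (nbh v j)))"
    using fin by (intro sum_mono2) (auto simp: nbh_def)
  also have "\<dots> = real (card (Sigma \<Lambda> (nbh v)))"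
    using fin fin_nbh by (subst card_SigmaI) auto
  also have "Sigma \<Lambda> (nbh v) = {(i, j). i \<in> \<Lambda> \<and> j \<in> nbh v i}" by auto
  finally have "4/9 * (real (card \<Lambda>))\<^sup>2 < real (card {(i, j). i \<in> \<Lambda> \<and> j \<in> nbh v i})"
    using i(2) by linarith
  moreover have "0 \<le> (real (card \<Lambda>))\<^sup>2" by simp
  ultimately show ?thesis by linarith
qed

text \<open>Three links, each with more than a third of all ordered pairs, cannot be disjoint. A
  pair common to two of them is completed to an edge by either vertex, and the difference of the two
  edges identifies these vertices.\<close>

lemma two_classes:
  assumes "x \<in> \<Lambda>" "y \<in> \<Lambda>" "z \<in> \<Lambda>"
  shows "cls x y \<or> cls x z \<or> cls y z"
proof (rule ccontr)
  assume neg: "\<not> ?thesis"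
  define A where "A v = {(i, j). i \<in> \<Lambda> \<and> j \<in> nbh v i}" for v
  have sub: "A v \<subseteq> \<Lambda> \<times> \<Lambda>" for v unfolding A_def nbh_def by auto
  have finA: "finite (A v)" for v using finite_subset[OF sub] fin by simp
  have dj: "A a \<inter> A b = {}" if "\<not> cls a b" "a \<in> \<Lambda>" "b \<in> \<Lambda>" for a b
    using that cls_shared[of a _ _ b] nbh_FL unfolding A_def by blast
  hence "card (A x \<union> A y \<union> A z) = card (A x) + card (A y) + card (A z)"
    using dj[of x y] dj[of x z] dj[of y z] neg assms finA
    by (simp add: card_Un_disjoint Int_Un_distrib2)
  moreover have "card (A x \<union> A y \<union> A z) \<le> card (\<Lambda> \<times> \<Lambda>)"
    using fin sub by (intro card_mono) auto
  ultimately have "real (card (A x)) + real (card (A y)) + real (card (A z)) \<le> real (card (\<Lambda> \<times> \<Lambda>))"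
    by linarith
  also have "\<dots> = (real (card \<Lambda>))\<^sup>2"
    by (simp add: card_cartesian_product power2_eq_square)
  finally show False
    using link_density[OF assms(1)] link_density[OF assms(2)] link_density[OF assms(3)]
    unfolding A_def by linarith
qed

text \<open>Every edge of the link of v crosses between X and Y, so the two steps of a walk end in
  opposite sides, leaving at most \<open>card X * card Y\<close> walks, a quarter of the square of
  the order.\<close>

lemma link_bipartite_impossible:
  assumes XY: "X \<union> Y = \<Lambda>" "X \<inter> Y = {}" and v: "v \<in> X"
    and two: "\<And>e. e \<in> FL \<Longrightarrow> v \<in> e \<Longrightarrow> card (e \<inter> X) = 2"
  shows False
proof -
  have v\<Lambda>: "v \<in> \<Lambda>" using v XY by blast
  obtain i where i: "i \<in> \<Lambda>" "4/9 * (real (card \<Lambda>))\<^sup>2 < (\<Sum>j\<in>nbh v i. real (card (nbh v j)))"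
    using walks[of v] v\<Lambda> by blast
  have finXY: "finite X" "finite Y" using XY fin(1) by auto
  have one: "i \<in> X \<longleftrightarrow> j \<notin> X" if "i \<in> \<Lambda>" "j \<in> nbh v i" for i j
  proof -
    have e: "{v, i, j} \<in> FL" using nbh_FL[OF v\<Lambda> that] .
    hence "v \<noteq> i" "v \<noteq> j" "i \<noteq> j" using distinct3 FL_def by blast+
    moreover have "card ({v, i, j} \<inter> X) = 2" using two[OF e] by simp
    ultimately show ?thesis using v
      by (cases "i \<in> X"; cases "j \<in> X") auto
  qed
  have X: "nbh v j \<subseteq> Y" if "j \<in> X" for j
    using one[of j] that XY unfolding nbh_def by blast
  have Y: "nbh v j \<subseteq> X" if "j \<in> Y" for j
    using one[of j] that XY unfolding nbh_def by blast
  have bound: "(\<Sum>j\<in>nbh v i. real (card (nbh v j))) \<le> real (card A) * real (card B)"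
    if "nbh v i \<subseteq> A" "\<And>j. j \<in> A \<Longrightarrow> nbh v j \<subseteq> B" "finite A" "finite B" for A B
  proof -
    have "(\<Sum>j\<in>nbh v i. real (card (nbh v j))) \<le> real (card (nbh v i)) * real (card B)"
      using that by (intro sum_bounded_above) (auto intro!: card_mono)
    also have "\<dots> \<le> real (card A) * real (card B)"
      using that by (intro mult_right_mono) (auto intro!: card_mono)
    finally show ?thesis .
  qed
  have "(\<Sum>j\<in>nbh v i. real (card (nbh v j))) \<le> real (card X) * real (card Y)"
  proof (cases "i \<in> X")
    case True
    thus ?thesis using bound[of Y X] X Y finXY by (simp add: mult.commute)
  next
    case False
    hence "i \<in> Y" using i XY by blast
    thus ?thesis using bound[of X Y] X Y finXY by simp
  qed
  also have "\<dots> \<le> 1/4 * (real (card X) + real (card Y))\<^sup>2"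
    using sum_squares_ge_zero[of "real (card X) - real (card Y)" 0]
    by (simp add: power2_eq_square algebra_simps)
  also have "real (card X) + real (card Y) = real (card \<Lambda>)"
    using XY finXY card_Un_disjoint[of X Y] by simp
  finally have "(\<Sum>j\<in>nbh v i. real (card (nbh v j))) \<le> 1/4 * (real (card \<Lambda>))\<^sup>2" .
  moreover have "0 < (real (card \<Lambda>))\<^sup>2" using card_pos by simp
  ultimately show False using i(2) by linarith
qed

text \<open>Both steps of a walk in the link of v stay in X, so there are at most the square of
  \<open>card X\<close> of them.\<close>

lemma link_clique_large:
  assumes XY: "X \<union> Y = \<Lambda>" "X \<inter> Y = {}" and v: "v \<in> X"
    and three: "\<And>e. e \<in> FL \<Longrightarrow> v \<in> e \<Longrightarrow> e \<subseteq> X"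
  shows "2/3 * real (card \<Lambda>) < real (card X)"
proof -
  have v\<Lambda>: "v \<in> \<Lambda>" using v XY by blast
  have finX: "finite X" using XY fin(1) by auto
  obtain i where i: "i \<in> \<Lambda>" "4/9 * (real (card \<Lambda>))\<^sup>2 < (\<Sum>j\<in>nbh v i. real (card (nbh v j)))"
    using walks[of v] v\<Lambda> by blast
  have sub: "nbh v j \<subseteq> X" if "j \<in> \<Lambda>" for j
    using three nbh_FL[OF v\<Lambda> that] by blast
  have "(\<Sum>j\<in>nbh v i. real (card (nbh v j))) \<le> real (card (nbh v i)) * real (card X)"
    using sub finX by (intro sum_bounded_above) (auto intro!: card_mono simp: nbh_def)
  also have "\<dots> \<le> real (card X) * real (card X)"
    using sub[OF i(1)] finX by (intro mult_right_mono) (auto intro!: card_mono)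
  finally have "(2/3 * real (card \<Lambda>))\<^sup>2 < (real (card X))\<^sup>2"
    using i(2) by (simp add: power2_eq_square)
  thus ?thesis by (rule power2_less_imp_less) simp
qed

text \<open>Modulo the lattice an edge depends only on how many of its vertices lie in the class X
  of p, and two edges whose counts differ by 1 would identify p with q. So if some edge has count 2,
  all edges at p do; if some edge has count 1, all edges at q do; either way a link is bipartite.
  Otherwise every edge lies in one class, and both classes would exceed two thirds of
  \<Lambda>.\<close>

lemma one_class:
  assumes "p \<in> \<Lambda>" "q \<in> \<Lambda>"
  shows "cls p q"
proof (rule ccontr)
  assume npq: "\<not> cls p q"
  define X where "X = {x\<in>\<Lambda>. cls x p}"
  define Y where "Y = {x\<in>\<Lambda>. \<not> cls x p}"
  have XY: "X \<union> Y = \<Lambda>" "X \<inter> Y = {}" and YX: "Y \<union> X = \<Lambda>" "Y \<inter> X = {}"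
    unfolding X_def Y_def by auto
  have p: "p \<in> X" and q: "q \<in> Y"
    using assms cls_refl npq cls_sym unfolding X_def Y_def by blast+
  have Ycls: "cls x q" if "x \<in> Y" for x
    using two_classes[of x p q] that assms npq unfolding Y_def by blast
  define r where "r x = (if x \<in> X then p else q)" for x
  have r: "cls x (r x)" if "x \<in> \<Lambda>" for x
    using that Ycls unfolding r_def X_def Y_def by auto
  define rep where "rep a u = int a * of_bool (u = p) + (3 - int a) * of_bool (u = q)" for a u
  have rep: "lat (rep (card (e \<inter> X)))" if e: "e \<in> FL" for e
  proof -
    \<comment> \<open>Moving each vertex of e to the representative of its class changes e by a
      lattice vector and turns it into \<open>rep (card (e \<inter> X))\<close>.\<close>
    have "lat (\<lambda>u. \<Sum>x\<in>e. 1 * (of_bool (u = x) - of_bool (u = r x)))"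
      using FL_edge[OF e] r unfolding cls_def by (intro lat_sum) auto
    hence "lat (\<lambda>u. of_bool (u \<in> e) + (- 1) * (\<Sum>x\<in>e. 1 * (of_bool (u = x) - of_bool (u = r x))))"
      by (intro lat_lincomb lat_edge e)
    thus ?thesis
    proof (rule lat_cong)
      fix u
      have fe: "finite e" "card e = 3" "e \<subseteq> \<Lambda>" using FL_edge[OF e] by auto
      have "(\<Sum>x\<in>e. of_bool (u = x)) = (of_bool (u \<in> e) :: int)"
        using fe by (simp add: of_bool_def)
      moreover have "(\<Sum>x\<in>e. of_bool (u = r x)) = (\<Sum>x\<in>e. if x \<in> X then of_bool (u = p) else of_bool (u = q) :: int)"
        unfolding r_def by (intro sum.cong) auto
      moreover have "\<dots> = int (card (e \<inter> X)) * of_bool (u = p) + int (card (e - X)) * of_bool (u = q)"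
        using fe by (simp add: sum.If_cases Diff_eq)
      moreover have "int (card (e - X)) = 3 - int (card (e \<inter> X))"
        using fe card_Int_Diff[of e X] by simp
      ultimately show "of_bool (u \<in> e) + (- 1) * (\<Sum>x\<in>e. 1 * (of_bool (u = x) - of_bool (u = r x)))
          = rep (card (e \<inter> X)) u"
        by (simp add: rep_def sum_subtractf del: sum_of_bool_eq)
    qed
  qed
  have no_succ: False if "e \<in> FL" "f \<in> FL" "card (e \<inter> X) = Suc (card (f \<inter> X))" for e f
  proof -
    have "lat (\<lambda>u. rep (Suc (card (f \<inter> X))) u + (- 1) * rep (card (f \<inter> X)) u)"
      using rep[OF that(1)] rep[OF that(2)] that(3) by (intro lat_lincomb) auto
    hence "lat (\<lambda>u. of_bool (u = p) - of_bool (u = q))"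
      by (rule lat_cong) (simp add: rep_def algebra_simps)
    thus False using npq unfolding cls_def by blast
  qed
  have le3: "card (e \<inter> X) \<le> 3" and Y3: "card (e \<inter> Y) = 3 - card (e \<inter> X)" if "e \<in> FL" for e
  proof -
    have fe: "finite e" "card e = 3" "e \<subseteq> \<Lambda>" using FL_edge[OF that] by auto
    show "card (e \<inter> X) \<le> 3" using fe card_mono[of e "e \<inter> X"] by simp
    have "e \<inter> Y = e - X" using fe XY by blast
    thus "card (e \<inter> Y) = 3 - card (e \<inter> X)" using fe card_Int_Diff[of e X] by simp
  qed
  have pos: "card (e \<inter> Z) \<noteq> 0" if "e \<in> FL" "x \<in> e" "x \<in> Z" for e x Z
    using that FL_edge[OF that(1)] by auto
  consider f where "f \<in> FL" "card (f \<inter> X) = 2" | f where "f \<in> FL" "card (f \<inter> X) = 1"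
    | "\<And>f. f \<in> FL \<Longrightarrow> card (f \<inter> X) = 0 \<or> card (f \<inter> X) = 3"
  proof -
    have "card (f \<inter> X) \<in> {0, 1, 2, 3}" if "f \<in> FL" for f
      using le3[OF that] by auto
    thus ?thesis using that by blast
  qed
  thus False
  proof cases
    case 1
    show False
    proof (rule link_bipartite_impossible[OF XY p])
      fix e assume "e \<in> FL" "p \<in> e"
      thus "card (e \<inter> X) = 2"
        using no_succ[of f e] no_succ[of e f] 1 le3[of e] pos[of e p X] p by fastforce
    qed
  next
    case 2
    show False
    proof (rule link_bipartite_impossible[OF YX q])
      fix e assume e: "e \<in> FL" "q \<in> e"
      have "card (e \<inter> X) = 1"
        using no_succ[of f e] no_succ[of e f] 2 le3[of e] pos[of e q Y] q Y3[of e] e by fastforce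
      thus "card (e \<inter> Y) = 2" using Y3[OF e(1)] by simp
    qed
  next
    case 3
    have "2/3 * real (card \<Lambda>) < real (card X)"
    proof (rule link_clique_large[OF XY p])
      fix e assume e: "e \<in> FL" "p \<in> e"
      have "card (e \<inter> X) = card e" using 3[OF e(1)] pos[OF e p] FL_edge[OF e(1)] by simp
      thus "e \<subseteq> X" using FL_edge[OF e(1)] card_subset_eq[of e "e \<inter> X"] by auto
    qed
    moreover have "2/3 * real (card \<Lambda>) < real (card Y)"
    proof (rule link_clique_large[OF YX q])
      fix e assume e: "e \<in> FL" "q \<in> e"
      have "card (e \<inter> Y) = card e" using 3[OF e(1)] Y3[OF e(1)] pos[OF e q] FL_edge[OF e(1)] by auto
      thus "e \<subseteq> Y" using FL_edge[OF e(1)] card_subset_eq[of e "e \<inter> Y"] by auto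
    qed
    moreover have "card \<Lambda> = card X + card Y"
      using XY fin(1) card_Un_disjoint[of X Y] by (metis finite_Un)
    ultimately show False using card_pos by simp
  qed
qed

text \<open>With a single class, all of g can be moved to one vertex p. What remains is a multiple
  of 3 at p, and 3 at p is an edge through p with all its vertices moved there.\<close>

lemma lat_full:
  assumes "3 dvd sum g \<Lambda>"
  shows "lat g"
proof -
  obtain p where p: "p \<in> \<Lambda>" using nonempty by blast
  obtain i j where "i \<in> \<Lambda>" "j \<in> \<Lambda>" "{p, i, j} \<in> F"
    using edge_at[of p] p by blast
  hence e: "{p, i, j} \<in> FL" using p by (simp add: FL_def)
  define d where "d x u = (of_bool (u = x) - of_bool (u = p) :: int)" for x u
  have d: "lat (d x)" if "x \<in> \<Lambda>" for x
    using one_class[OF that p] unfolding cls_def d_def .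
  obtain k where k: "sum g \<Lambda> = 3 * k" using assms by blast
  have "lat (\<lambda>u. of_bool (u \<in> {p, i, j}) + (- 1) * (\<Sum>x\<in>{p, i, j}. 1 * d x u))"
    using e d FL_edge[OF e] by (intro lat_lincomb lat_edge lat_sum) auto
  hence 3: "lat (\<lambda>u. 3 * of_bool (u = p))"
  proof (rule lat_cong)
    fix u
    have "p \<noteq> i" "p \<noteq> j" "i \<noteq> j" using e distinct3 unfolding FL_def by blast+
    thus "of_bool (u \<in> {p, i, j}) + (- 1) * (\<Sum>x\<in>{p, i, j}. 1 * d x u) = 3 * of_bool (u = p)"
      by (auto simp: d_def)
  qed
  have "lat (\<lambda>u. (\<Sum>x\<in>\<Lambda>. g x * d x u) + k * (3 * of_bool (u = p)))"
    using d fin by (intro lat_lincomb lat_sum 3) auto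
  thus ?thesis
  proof (rule lat_cong)
    fix u assume u: "u \<in> \<Lambda>"
    have "(\<Sum>x\<in>\<Lambda>. g x * d x u) = (\<Sum>x\<in>\<Lambda>. g x * of_bool (u = x)) - sum g \<Lambda> * of_bool (u = p)"
      by (simp add: d_def right_diff_distrib sum_subtractf sum_distrib_right del: sum_mult_of_bool_eq)
    also have "(\<Sum>x\<in>\<Lambda>. g x * of_bool (u = x)) = (\<Sum>x\<in>\<Lambda>. if u = x then g x else 0)"
      by (intro sum.cong) auto
    also have "\<dots> = g u" using u fin by simp
    finally show "(\<Sum>x\<in>\<Lambda>. g x * d x u) + k * (3 * of_bool (u = p)) = g u"
      using k by simp
  qed
qed

text \<open>Every vertex of \<open>U\<close> gets one edge into \<open>\<Lambda>\<close>; what remains of a large multiple of the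
  all-ones vector lies in the lattice of the edges inside \<open>\<Lambda>\<close> and deep inside their cone.\<close>

theorem integral_matching:
  obtains D :: nat and z :: "'l set \<Rightarrow> nat"
  where "\<And>x. x \<in> \<Lambda> \<Longrightarrow> (\<Sum>e\<in>F. z e * of_bool (x \<in> e)) = D"
    and "\<And>x. x \<in> U \<Longrightarrow> (\<Sum>e\<in>F. z e * of_bool (x \<in> e)) = 1"
proof -
  have "\<forall>u\<in>U. \<exists>e\<in>F. e \<inter> U = {u}"
  proof
    fix u assume u: "u \<in> U"
    then obtain i j where "i \<in> \<Lambda>" "j \<in> \<Lambda>" "{u, i, j} \<in> F" using edge_at[of u] by blast
    thus "\<exists>e\<in>F. e \<inter> U = {u}" using u disj by (intro bexI[of _ "{u, i, j}"]) auto
  qed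
  then obtain eu where eu: "\<And>u. u \<in> U \<Longrightarrow> eu u \<in> F" "\<And>u. u \<in> U \<Longrightarrow> eu u \<inter> U = {u}"
    by metis
  have inj: "inj_on eu U"
    using eu(2) by (intro inj_onI) (metis singleton_inject)
  have disjF: "eu ` U \<inter> FL = {}"
  proof -
    have "eu u \<notin> FL" if "u \<in> U" for u
      using eu(2)[OF that] disj that unfolding FL_def by blast
    thus ?thesis by blast
  qed
  \<comment> \<open>The contribution of the edges \<open>eu u\<close> inside \<Lambda>, to be
    cancelled. Each has two vertices there, so the total is \<open>- 2 * card U\<close>, a multiple
    of 3.\<close>
  define g where "g x = - (\<Sum>u\<in>U. of_bool (x \<in> eu u) :: int)" for x
  have "(\<Sum>x\<in>\<Lambda>. of_bool (x \<in> eu u) :: int) = 2" if u: "u \<in> U" for u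
  proof -
    have e: "eu u \<subseteq> \<Lambda> \<union> U" "card (eu u) = 3" using edge eu(1)[OF u] by blast+
    have "eu u = insert u (\<Lambda> \<inter> eu u)" using e eu(2)[OF u] u by blast
    moreover have "u \<notin> \<Lambda>" using u disj by blast
    ultimately have "card (\<Lambda> \<inter> eu u) = 2"
      using e(2) fin(1) by (metis Int_iff card_insert_disjoint diff_Suc_1 finite_Int numeral_3_eq_3 numeral_2_eq_2)
    thus ?thesis using fin by (simp add: Int_def)
  qed
  hence "sum g \<Lambda> = - 2 * int (card U)"
    unfolding g_def by (simp add: sum_negf sum.swap[of _ U \<Lambda>] del: sum_of_bool_eq)
  hence "lat g" using dvd3 by (intro lat_full) auto
  then obtain c where c: "\<And>x. x \<in> \<Lambda> \<Longrightarrow> g x = (\<Sum>e\<in>FL. c e * of_bool (x \<in> e))"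
    unfolding lat_def by blast
  obtain q :: "'l set \<Rightarrow> nat" and S :: nat where q: "\<And>e. e \<in> FL \<Longrightarrow> 0 < q e"
    and S: "\<And>x. x \<in> \<Lambda> \<Longrightarrow> S = (\<Sum>e\<in>FL. q e * of_bool (x \<in> e))"
    using integer_interior by metis
  \<comment> \<open>Since every \<open>q e\<close> is at least 1, adding K copies of q makes all
    coefficients c nonnegative, and it raises all degrees in \<Lambda> by the same amount
    \<open>K * S\<close>, the final value of D.\<close>
  define K where "K = (\<Sum>e\<in>FL. \<bar>c e\<bar>)"
  have K: "0 \<le> c e + K * int (q e)" if "e \<in> FL" for e
  proof -
    have "\<bar>c e\<bar> \<le> K" unfolding K_def using finFL that by (intro member_le_sum) auto
    moreover have "K * 1 \<le> K * int (q e)"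
      using q[OF that] calculation by (intro mult_left_mono) auto
    ultimately show ?thesis by linarith
  qed
  define z where "z e = (if e \<in> FL then nat (c e + K * int (q e)) else of_bool (e \<in> eu ` U))" for e
  have split: "(\<Sum>e\<in>F. z e * of_bool (x \<in> e)) = (\<Sum>e\<in>FL. z e * of_bool (x \<in> e)) + (\<Sum>u\<in>U. of_bool (x \<in> eu u))" for x
  proof -
    have "(\<Sum>e\<in>F. z e * of_bool (x \<in> e)) = (\<Sum>e\<in>FL \<union> eu ` U. z e * of_bool (x \<in> e))"
      using finF eu(1) by (intro sum.mono_neutral_right) (auto simp: z_def FL_def)
    also have "\<dots> = (\<Sum>e\<in>FL. z e * of_bool (x \<in> e)) + (\<Sum>e\<in>eu ` U. z e * of_bool (x \<in> e))"
      using finFL fin disjF by (intro sum.union_disjoint) auto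
    also have "(\<Sum>e\<in>eu ` U. z e * of_bool (x \<in> e)) = (\<Sum>u\<in>U. z (eu u) * of_bool (x \<in> eu u))"
      using inj by (simp add: sum.reindex del: sum_mult_of_bool_eq)
    also have "\<dots> = (\<Sum>u\<in>U. of_bool (x \<in> eu u))"
      using disjF by (intro sum.cong) (auto simp: z_def)
    finally show ?thesis .
  qed
  show ?thesis
  proof (rule that)
    fix x assume x: "x \<in> \<Lambda>"
    have "int (\<Sum>e\<in>FL. z e * of_bool (x \<in> e)) = (\<Sum>e\<in>FL. (c e + K * int (q e)) * of_bool (x \<in> e))"
      unfolding of_nat_sum using K by (intro sum.cong) (auto simp: z_def)
    also have "\<dots> = g x + K * (\<Sum>e\<in>FL. int (q e) * of_bool (x \<in> e))"
      by (simp add: c[OF x] ring_distribs sum.distrib sum_distrib_left mult.assoc del: sum_mult_of_bool_eq)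
    also have "(\<Sum>e\<in>FL. int (q e) * of_bool (x \<in> e)) = int S"
      unfolding S[OF x] of_nat_sum by (intro sum.cong) auto
    finally have "int (\<Sum>e\<in>F. z e * of_bool (x \<in> e)) = K * int S"
      unfolding split of_nat_add by (simp add: g_def del: sum_mult_of_bool_eq sum_of_bool_eq)
    thus "(\<Sum>e\<in>F. z e * of_bool (x \<in> e)) = nat (K * int S)" by linarith
  next
    fix x assume x: "x \<in> U"
    have "(\<Sum>e\<in>FL. z e * of_bool (x \<in> e)) = 0"
      using x disj FL_edge by (intro sum.neutral) auto
    moreover have "(\<Sum>u\<in>U. of_bool (x \<in> eu u)) = (\<Sum>u\<in>U. of_bool (u = x) :: nat)"
    proof (intro sum.cong refl)
      fix u assume "u \<in> U"
      hence "x \<in> eu u \<inter> U \<longleftrightarrow> x \<in> {u}" using eu(2) by simp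
      hence "x \<in> eu u \<longleftrightarrow> u = x" using x by auto
      thus "of_bool (x \<in> eu u) = (of_bool (u = x) :: nat)" by simp
    qed
    moreover have "\<dots> = 1" using x fin by (simp add: of_bool_def)
    ultimately show "(\<Sum>e\<in>F. z e * of_bool (x \<in> e)) = 1" unfolding split by simp
  qed
qed

end

subsection \<open>Complete multipartite patterns and blow-ups\<close>

text \<open>Greedy: a copy of an edge of positive weight takes one vertex from each of its parts,
  and lowering its weight by 1 restores the equality of degrees and part sizes. No part runs out
  early, because its size is the total weight still to be served.\<close>

lemma blowup_matching:
  fixes z :: "'l set \<Rightarrow> nat" and V :: "'l \<Rightarrow> 'v set"
  assumes "finite L" "finite F" and "\<And>e. e \<in> F \<Longrightarrow> e \<subseteq> L"
    and "\<And>x. x \<in> L \<Longrightarrow> finite (V x)" "disjoint_family_on V L"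
    and "\<And>x. x \<in> L \<Longrightarrow> (\<Sum>e\<in>F. z e * of_bool (x \<in> e)) = card (V x)"
  shows "\<exists>M. pairwise disjnt M \<and> \<Union>M = (\<Union>x\<in>L. V x) \<and>
    (\<forall>m\<in>M. \<exists>e\<in>F. \<exists>f. (\<forall>x\<in>e. f x \<in> V x) \<and> m = f ` e)"
  using assms(4-)
proof (induction "sum z F" arbitrary: z V)
  case 0
  hence "\<forall>e\<in>F. z e = 0" using \<open>finite F\<close> by simp
  hence "card (V x) = 0" if "x \<in> L" for x
    using 0(4)[OF that] by simp
  hence "V x = {}" if "x \<in> L" for x
    using 0(2) that by simp
  thus ?case by (intro exI[of _ "{}"]) auto
next
  case (Suc k)
  have "sum z F \<noteq> 0" using Suc(2) by simp
  then obtain e where e: "e \<in> F" "0 < z e" using \<open>finite F\<close> by auto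
  have ne: "V x \<noteq> {}" if "x \<in> e" for x
  proof -
    have "x \<in> L" using assms(3)[OF e(1)] that by blast
    have "z e * of_bool (x \<in> e) \<le> (\<Sum>e\<in>F. z e * of_bool (x \<in> e))"
      using e(1) \<open>finite F\<close> by (intro member_le_sum) auto
    thus ?thesis using e that Suc.prems(3)[OF \<open>x \<in> L\<close>] by auto
  qed
  define f where "f x = (SOME y. y \<in> V x)" for x
  have f: "f x \<in> V x" if "x \<in> e" for x
    using ne[OF that] unfolding f_def by (simp add: some_in_eq)
  define z' where "z' = z(e := z e - 1)"
  define V' where "V' x = (if x \<in> e then V x - {f x} else V x)" for x
  have sum': "(\<Sum>e\<in>F. z e * g e) = (\<Sum>e\<in>F. z' e * g e) + g e" for g :: "'l set \<Rightarrow> nat"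
  proof -
    have "(\<Sum>e\<in>F. z e * g e) = z e * g e + (\<Sum>e\<in>F - {e}. z e * g e)"
      by (rule sum.remove[OF \<open>finite F\<close> e(1)])
    also have "z e * g e = z' e * g e + g e"
      using e(2) by (simp add: z'_def mult_eq_if)
    also have "(\<Sum>e\<in>F - {e}. z e * g e) = (\<Sum>e\<in>F - {e}. z' e * g e)"
      by (intro sum.cong) (auto simp: z'_def)
    also have "z' e * g e + g e + (\<Sum>e\<in>F - {e}. z' e * g e) = (\<Sum>e\<in>F. z' e * g e) + g e"
      using sum.remove[OF \<open>finite F\<close> e(1), of "\<lambda>e. z' e * g e"] by simp
    finally show ?thesis .
  qed
  have "\<exists>M. pairwise disjnt M \<and> \<Union>M = (\<Union>x\<in>L. V' x) \<and>
    (\<forall>m\<in>M. \<exists>e\<in>F. \<exists>f. (\<forall>x\<in>e. f x \<in> V' x) \<and> m = f ` e)"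
  proof (rule Suc.hyps(1))
    show "k = sum z' F" using Suc.hyps(2) sum'[of "\<lambda>_. 1"] by simp
    show "finite (V' x)" if "x \<in> L" for x using Suc.prems(1)[OF that] by (simp add: V'_def)
    show "disjoint_family_on V' L"
      using Suc.prems(2) unfolding disjoint_family_on_def V'_def by auto
    show "(\<Sum>e\<in>F. z' e * of_bool (x \<in> e)) = card (V' x)" if x: "x \<in> L" for x
    proof -
      have "(\<Sum>e\<in>F. z' e * of_bool (x \<in> e)) + of_bool (x \<in> e) = card (V x)"
        using Suc.prems(3)[OF x] sum'[of "\<lambda>e. of_bool (x \<in> e)"] by simp
      thus ?thesis using f Suc.prems(1)[OF x] by (auto simp: V'_def)
    qed
  qed
  then obtain M where M: "pairwise disjnt M" "\<Union>M = (\<Union>x\<in>L. V' x)"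
    "\<forall>m\<in>M. \<exists>e\<in>F. \<exists>f. (\<forall>x\<in>e. f x \<in> V' x) \<and> m = f ` e"
    by (elim exE conjE)
  have V'V: "V' x \<subseteq> V x" for x by (auto simp: V'_def)
  have fV': "f x \<notin> V' y" if "x \<in> e" "y \<in> L" for x y
  proof (cases "x = y")
    case True
    thus ?thesis using that by (simp add: V'_def)
  next
    case False
    hence "V x \<inter> V y = {}"
      using Suc.prems(2) that assms(3)[OF e(1)] unfolding disjoint_family_on_def by blast
    thus ?thesis using f[OF that(1)] V'V by blast
  qed
  show ?case
  proof (intro exI[of _ "insert (f ` e) M"] conjI ballI)
    have "f ` e \<inter> \<Union>M = {}" unfolding M(2) using fV' by blast
    thus "pairwise disjnt (insert (f ` e) M)"
      using M(1) by (auto simp: pairwise_insert disjnt_def)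
    have "(\<Union>x\<in>L. V x) = f ` e \<union> (\<Union>x\<in>L. V' x)"
    proof (intro equalityI subsetI)
      fix y assume "y \<in> (\<Union>x\<in>L. V x)"
      then obtain x where "x \<in> L" "y \<in> V x" by blast
      thus "y \<in> f ` e \<union> (\<Union>x\<in>L. V' x)"
        by (cases "y \<in> f ` e") (auto simp: V'_def intro!: bexI[of _ x])
    next
      fix y assume "y \<in> f ` e \<union> (\<Union>x\<in>L. V' x)"
      thus "y \<in> (\<Union>x\<in>L. V x)"
      proof
        assume "y \<in> f ` e"
        then obtain x where "x \<in> e" "y = f x" by blast
        thus ?thesis using f[of x] assms(3)[OF e(1)] by blast
      next
        assume "y \<in> (\<Union>x\<in>L. V' x)"
        then obtain x where "x \<in> L" "y \<in> V' x" by blast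
        thus ?thesis using V'V[of x] by blast
      qed
    qed
    thus "\<Union>(insert (f ` e) M) = (\<Union>x\<in>L. V x)" using M(2) by simp
    fix m assume "m \<in> insert (f ` e) M"
    thus "\<exists>e\<in>F. \<exists>f. (\<forall>x\<in>e. f x \<in> V x) \<and> m = f ` e"
    proof
      assume "m = f ` e"
      thus ?thesis using f by (intro bexI[OF _ e(1)] exI[of _ f]) simp
    next
      assume "m \<in> M"
      obtain e' f' where "e' \<in> F" "\<forall>x\<in>e'. f' x \<in> V' x" "m = f' ` e'"
        using M(3)[rule_format, OF \<open>m \<in> M\<close>] by (elim bexE exE conjE)
      thus ?thesis using V'V by (intro bexI[of _ e'] exI[of _ f']) auto
    qed
  qed
qed

lemma card_PiE_fibers:
  assumes "finite P" "finite I" "i \<notin> I" "E \<subseteq> (\<Pi>\<^sub>E j\<in>insert i I. P)"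
  shows "card E = (\<Sum>a\<in>P. card {g \<in> (\<Pi>\<^sub>E j\<in>I. P). g(i := a) \<in> E})"
proof -
  define H where "H a = {g \<in> (\<Pi>\<^sub>E j\<in>I. P). g(i := a) \<in> E}" for a
  have finH: "finite (H a)" for a
    unfolding H_def using assms by (simp add: finite_PiE)
  have "bij_betw (\<lambda>(a, g). g(i := a)) (Sigma P H) E"
  proof (rule bij_betwI[where g = "\<lambda>f. (f i, f(i := undefined))"])
    show "(\<lambda>(a, g). g(i := a)) \<in> Sigma P H \<rightarrow> E" by (auto simp: H_def)
    show "(\<lambda>f. (f i, f(i := undefined))) \<in> E \<rightarrow> Sigma P H"
      using assms by (fastforce simp: H_def PiE_def extensional_def Pi_def)
    fix x assume "x \<in> Sigma P H"
    thus "((case x of (a, g) \<Rightarrow> g(i := a)) i, (case x of (a, g) \<Rightarrow> g(i := a))(i := undefined)) = x"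
      using assms(3) by (auto simp: H_def PiE_def extensional_def fun_eq_iff)
  qed (auto simp: fun_eq_iff)
  hence "card E = card (Sigma P H)" by (simp add: bij_betw_same_card)
  also have "\<dots> = (\<Sum>a\<in>P. card (H a))" using assms(1) finH by simp
  finally show ?thesis unfolding H_def .
qed

text \<open>The set \<open>X\<close> and the disjointness of the parts are built into the induction, so that the
  copies found later consist of distinct triples.\<close>

theorem erdos_complete_multipartite:
  assumes "0 < (\<delta>::real)"
  shows "\<exists>n\<^sub>0. \<forall>(P :: 'a set) X E. finite P \<and> n\<^sub>0 \<le> card P \<and> finite X \<and> card X \<le> b \<and>
      E \<subseteq> (\<Pi>\<^sub>E i\<in>{..<m}. P) \<and> \<delta> * real (card P) ^ m \<le> real (card E) \<longrightarrow>
      (\<exists>S. (\<forall>i<m. S i \<subseteq> P - X \<and> card (S i) = s) \<and> disjoint_family_on S {..<m} \<and>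
        (\<Pi>\<^sub>E i\<in>{..<m}. S i) \<subseteq> E)"
  using assms
proof (induction m arbitrary: \<delta> b)
  case 0
  have "E = {\<lambda>_. undefined}" if "E \<subseteq> {\<lambda>_. undefined}" "\<delta> \<le> real (card E)" for E :: "(nat \<Rightarrow> 'a) set"
    using that 0 by (cases "E = {}") auto
  thus ?case by (auto simp: disjoint_family_on_def)
next
  case (Suc m)
  \<comment> \<open>With \<open>s \<le> k * \<delta> / 4\<close>, the tuples extended by fewer than
    s elements of the k-set T make up at most half of the \<open>k * \<delta> / 2 * N ^ m\<close>
    extensions that are counted below.\<close>
  define k where "k = nat \<lceil>4 * real s / \<delta>\<rceil> + 1"
  have k: "real s \<le> real k * \<delta> / 4" "0 < k"
  proof -
    have "4 * real s / \<delta> \<le> real k" unfolding k_def by linarith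
    thus "real s \<le> real k * \<delta> / 4" using Suc.prems by (simp add: field_simps)
  qed (simp add: k_def)
  \<comment> \<open>The tuples in \<open>B'\<close> have density at least \<delta>/4 and are
    distributed over at most 2^k subsets of T; 8 in place of 4 makes the contradiction
    strict.\<close>
  define \<delta>' where "\<delta>' = \<delta> / (8 * 2 ^ k)"
  have "\<delta>' > 0" using Suc.prems by (simp add: \<delta>'_def)
  obtain n1 where n1: "\<forall>(P :: 'a set) X E. finite P \<and> n1 \<le> card P \<and> finite X \<and>
      card X \<le> b + s \<and> E \<subseteq> (\<Pi>\<^sub>E i\<in>{..<m}. P) \<and> \<delta>' * real (card P) ^ m \<le> real (card E) \<longrightarrow>
      (\<exists>S. (\<forall>i<m. S i \<subseteq> P - X \<and> card (S i) = s) \<and> disjoint_family_on S {..<m} \<and>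
        (\<Pi>\<^sub>E i\<in>{..<m}. S i) \<subseteq> E)"
    using Suc.IH[OF \<open>\<delta>' > 0\<close>, of "b + s"] by (elim exE)
  \<comment> \<open>The second entry ensures that, of the at least \<open>\<delta> / 2 * N\<close>
    elements with many extensions, k remain after X is removed.\<close>
  define n0 where "n0 = max (max n1 1) (nat \<lceil>2 * real (k + b) / \<delta>\<rceil>)"
  show ?case
  proof (intro exI[of _ n0] allI impI, elim conjE)
    fix P X :: "'a set" and E
    assume P: "finite P" "n0 \<le> card P" and X: "finite X" "card X \<le> b"
      and E: "E \<subseteq> (\<Pi>\<^sub>E i\<in>{..<Suc m}. P)" "\<delta> * real (card P) ^ Suc m \<le> real (card E)"
    have N: "n1 \<le> card P" "0 < card P" using P(2) by (auto simp: n0_def)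
    have "2 * real (k + b) / \<delta> \<le> real (card P)" using P(2) unfolding n0_def by linarith
    hence Nk: "real (k + b) \<le> \<delta> / 2 * real (card P)" using Suc.prems by (simp add: field_simps)
    define N where "N = real (card P)"
    have N0: "0 < N" using N by (simp add: N_def)
    define B where "B = (\<Pi>\<^sub>E i\<in>{..<m}. P)"
    have finB: "finite B" unfolding B_def using P by (intro finite_PiE) auto
    have cardB: "real (card B) = N ^ m" unfolding B_def N_def by (simp add: card_PiE)
    define H where "H a = {g \<in> B. g(m := a) \<in> E}" for a
    have HB: "H a \<subseteq> B" for a by (auto simp: H_def)
    have Hle: "real (card (H a)) \<le> N ^ m" for a
      unfolding cardB[symmetric] using card_mono[OF finB HB] by simp
    have cardE: "real (card E) = (\<Sum>a\<in>P. real (card (H a)))"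
      using card_PiE_fibers[of P "{..<m}" m E] P E by (simp add: H_def B_def lessThan_Suc)
    define G where "G = {a\<in>P. \<delta> / 2 * N ^ m \<le> real (card (H a))}"
    have "\<delta> * N ^ Suc m \<le> (\<Sum>a\<in>P. real (card (H a)))" using E(2) cardE by (simp add: N_def)
    also have "\<dots> \<le> (\<Sum>a\<in>P. (if a \<in> G then N ^ m else 0) + \<delta> / 2 * N ^ m)"
      using Hle Suc.prems N0 by (intro sum_mono) (auto simp: G_def add_increasing2)
    also have "\<dots> = real (card G) * N ^ m + N * (\<delta> / 2 * N ^ m)"
    proof -
      have "P \<inter> G = G" by (auto simp: G_def)
      thus ?thesis using P by (simp add: sum.distrib sum.If_cases N_def)
    qed
    finally have "(\<delta> / 2 * N) * N ^ m \<le> real (card G) * N ^ m"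
      by (simp add: field_simps)
    hence "\<delta> / 2 * N \<le> real (card G)" using N0 by simp
    hence "k + b \<le> card G" using Nk by (simp add: N_def)
    hence "k \<le> card (G - X)" using X diff_card_le_card_Diff[of X G] by linarith
    then obtain T where T: "T \<subseteq> G - X" "card T = k" "finite T"
      by (meson obtain_subset_with_card_n)
    define B' where "B' = {g\<in>B. s \<le> card {a\<in>T. g \<in> H a}}"
    have "real k * (\<delta> / 2 * N ^ m) \<le> (\<Sum>a\<in>T. real (card (H a)))"
      using sum_bounded_below[of T "\<delta> / 2 * N ^ m" "\<lambda>a. real (card (H a))"] T
      by (force simp: G_def)
    also have "\<dots> = (\<Sum>a\<in>T. \<Sum>g\<in>B. of_bool (g \<in> H a))"
    proof (intro sum.cong refl)
      fix a
      have "B \<inter> H a = H a" using HB by blast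
      thus "real (card (H a)) = (\<Sum>g\<in>B. of_bool (g \<in> H a))"
        using finB by simp
    qed
    also have "\<dots> = (\<Sum>g\<in>B. real (card {a\<in>T. g \<in> H a}))"
      using T(3) by (subst sum.swap) (simp add: Int_def)
    also have "\<dots> \<le> (\<Sum>g\<in>B. (if g \<in> B' then real k else 0) + real s)"
    proof (intro sum_mono)
      fix g assume "g \<in> B"
      moreover have "card {a\<in>T. g \<in> H a} \<le> k"
        unfolding T(2)[symmetric] using T(3) by (intro card_mono) auto
      ultimately show "real (card {a\<in>T. g \<in> H a}) \<le> (if g \<in> B' then real k else 0) + real s"
        by (auto simp: B'_def)
    qed
    also have "\<dots> = real (card B') * real k + N ^ m * real s"
    proof -
      have "B \<inter> B' = B'" by (auto simp: B'_def)
      thus ?thesis using finB by (simp add: sum.distrib sum.If_cases cardB)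
    qed
    also have "\<dots> \<le> real (card B') * real k + N ^ m * (real k * \<delta> / 4)"
      using k N0 by simp
    finally have "real k * (\<delta> / 4 * N ^ m) \<le> real k * real (card B')"
      by (simp add: field_simps)
    hence B': "\<delta> / 4 * N ^ m \<le> real (card B')" using k(2) by simp
    define C where "C S = {g\<in>B. \<forall>a\<in>S. g(m := a) \<in> E}" for S
    define SS where "SS = {S. S \<subseteq> T \<and> card S = s}"
    have finSS: "finite SS" unfolding SS_def using T(3) by simp
    have "\<exists>S\<in>SS. \<delta>' * N ^ m \<le> real (card (C S))"
    proof (rule ccontr)
      assume neg: "\<not> ?thesis"
      have "B' \<subseteq> (\<Union>S\<in>SS. C S)"
      proof
        fix g assume g: "g \<in> B'"
        then obtain S where "S \<subseteq> {a\<in>T. g \<in> H a}" "card S = s"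
          unfolding B'_def by (metis (no_types, lifting) mem_Collect_eq obtain_subset_with_card_n)
        thus "g \<in> (\<Union>S\<in>SS. C S)" using g by (auto simp: SS_def C_def H_def B'_def)
      qed
      hence "card B' \<le> card (\<Union>S\<in>SS. C S)"
        using finSS finB by (intro card_mono) (auto simp: C_def)
      also have "\<dots> \<le> (\<Sum>S\<in>SS. card (C S))" by (rule card_UN_le[OF finSS])
      finally have "real (card B') \<le> (\<Sum>S\<in>SS. real (card (C S)))"
        by (simp flip: of_nat_sum)
      also have "\<dots> \<le> real (card SS) * (\<delta>' * N ^ m)"
        using neg by (intro sum_bounded_above) (auto simp: not_le less_imp_le)
      also have "\<dots> \<le> 2 ^ k * (\<delta>' * N ^ m)"
      proof (intro mult_right_mono)
        have "card SS \<le> card (Pow T)" using T(3) by (intro card_mono) (auto simp: SS_def)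
        thus "real (card SS) \<le> 2 ^ k" using T by (simp add: card_Pow)
      qed (use \<open>\<delta>' > 0\<close> N0 in simp)
      also have "\<dots> = \<delta> / 8 * N ^ m" by (simp add: \<delta>'_def)
      finally have "\<delta> / 4 * N ^ m \<le> \<delta> / 8 * N ^ m" using B' by linarith
      thus False using Suc.prems N0 by simp
    qed
    then obtain S0 where S0: "S0 \<subseteq> T" "card S0 = s" "\<delta>' * N ^ m \<le> real (card (C S0))"
      unfolding SS_def by blast
    have "finite S0" using S0(1) T(3) finite_subset by blast
    \<comment> \<open>The new part \<open>S0\<close> joins the forbidden set, hence the bound
      \<open>b + s\<close> in the induction hypothesis.\<close>
    have "\<exists>S. (\<forall>i<m. S i \<subseteq> P - (X \<union> S0) \<and> card (S i) = s) \<and> disjoint_family_on S {..<m} \<and>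
        (\<Pi>\<^sub>E i\<in>{..<m}. S i) \<subseteq> C S0"
    proof (rule n1[rule_format], intro conjI)
      show "card (X \<union> S0) \<le> b + s" using card_Un_le[of X S0] X S0 by linarith
      show "C S0 \<subseteq> (\<Pi>\<^sub>E i\<in>{..<m}. P)" by (auto simp: C_def B_def)
      show "\<delta>' * real (card P) ^ m \<le> real (card (C S0))" using S0(3) by (simp add: N_def)
    qed (use P N X \<open>finite S0\<close> in auto)
    then obtain S where S': "\<forall>i<m. S i \<subseteq> P - (X \<union> S0) \<and> card (S i) = s"
      and S: "disjoint_family_on S {..<m}" "(\<Pi>\<^sub>E i\<in>{..<m}. S i) \<subseteq> C S0"
      by (elim exE conjE)
    have "(\<Pi>\<^sub>E i\<in>{..<Suc m}. (S(m := S0)) i) \<subseteq> E"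
    proof
      fix f assume f: "f \<in> (\<Pi>\<^sub>E i\<in>{..<Suc m}. (S(m := S0)) i)"
      have "f(m := undefined) \<in> (\<Pi>\<^sub>E i\<in>{..<m}. S i)"
      proof (rule PiE_I)
        fix i assume "i \<in> {..<m}"
        thus "(f(m := undefined)) i \<in> S i" using PiE_mem[OF f, of i] by auto
      next
        fix i assume "i \<notin> {..<m}"
        thus "(f(m := undefined)) i = undefined" using PiE_arb[OF f, of i] by auto
      qed
      hence "f(m := undefined) \<in> C S0" using S(2) by blast
      moreover have "f m \<in> S0" using PiE_mem[OF f, of m] by simp
      ultimately have "(f(m := undefined))(m := f m) \<in> E" unfolding C_def by blast
      thus "f \<in> E" by simp
    qed
    moreover have "disjoint_family_on (S(m := S0)) {..<Suc m}"
    proof -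
      have "S i \<inter> S0 = {}" if "i < m" for i using S' that by blast
      moreover from this have "S0 \<inter> S i = {}" if "i < m" for i using that by blast
      moreover have "S i \<inter> S j = {}" if "i < m" "j < m" "i \<noteq> j" for i j
        using S(1) that unfolding disjoint_family_on_def by simp
      ultimately have "(S(m := S0)) i \<inter> (S(m := S0)) j = {}"
        if "i < Suc m" "j < Suc m" "i \<noteq> j" for i j
        using that by (cases "i = m"; cases "j = m") (simp_all add: less_Suc_eq)
      thus ?thesis unfolding disjoint_family_on_def by blast
    qed
    moreover have "\<forall>i<Suc m. (S(m := S0)) i \<subseteq> P - X \<and> card ((S(m := S0)) i) = s"
      using S' S0 T by (auto simp: less_Suc_eq G_def)
    ultimately show "\<exists>S. (\<forall>i<Suc m. S i \<subseteq> P - X \<and> card (S i) = s) \<and>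
        disjoint_family_on S {..<Suc m} \<and> (\<Pi>\<^sub>E i\<in>{..<Suc m}. S i) \<subseteq> E" by blast
  qed
qed

subsection \<open>Spectra of link graphs\<close>

text \<open>Makes the \<open>Max\<close> in \<open>graph_spectral_radius\<close> an actual
  eigenvalue. A complex eigenvalue exists, the Hermitian form at its eigenvector shows that it is
  real, and a real root of the complexified characteristic polynomial is a root of the original
  one.\<close>

lemma symmetric_spectrum_nonempty:
  fixes A :: "real mat"
  assumes A: "A \<in> carrier_mat n n" and n: "0 < n"
    and sym: "\<And>i j. i < n \<Longrightarrow> j < n \<Longrightarrow> A $$ (i, j) = A $$ (j, i)"
  shows "spectrum A \<noteq> {}"
proof -
  define C :: "complex mat" where "C = map_mat of_real A"
  have C: "C \<in> carrier_mat n n" using A by (simp add: C_def)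
  obtain k where k: "k \<in> spectrum C" using spectrum_non_empty[OF C] n by auto
  then obtain v where v: "v \<in> carrier_vec n" "v \<noteq> 0\<^sub>v n" "C *\<^sub>v v = k \<cdot>\<^sub>v v"
    using C unfolding spectrum_def eigenvalue_def eigenvector_def by auto
  have row: "(\<Sum>j<n. of_real (A $$ (i, j)) * v $ j) = k * v $ i" if i: "i < n" for i
  proof -
    have "(C *\<^sub>v v) $ i = (k \<cdot>\<^sub>v v) $ i" using v(3) by simp
    thus ?thesis using i v(1) A by (simp add: C_def scalar_prod_def lessThan_atLeast0)
  qed
  define q where "q = (\<Sum>i<n. \<Sum>j<n. cnj (v $ i) * of_real (A $$ (i, j)) * v $ j)"
  define s where "s = (\<Sum>i<n. (cmod (v $ i))\<^sup>2)"
  have "q = (\<Sum>i<n. cnj (v $ i) * (\<Sum>j<n. of_real (A $$ (i, j)) * v $ j))"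
    unfolding q_def by (simp add: sum_distrib_left mult.assoc)
  also have "\<dots> = (\<Sum>i<n. k * of_real ((cmod (v $ i))\<^sup>2))"
  proof (intro sum.cong refl)
    fix i assume "i \<in> {..<n}"
    hence "cnj (v $ i) * (\<Sum>j<n. of_real (A $$ (i, j)) * v $ j) = k * (v $ i * cnj (v $ i))"
      using row[of i] by simp
    thus "cnj (v $ i) * (\<Sum>j<n. of_real (A $$ (i, j)) * v $ j) = k * of_real ((cmod (v $ i))\<^sup>2)"
      by (simp only: complex_norm_square)
  qed
  finally have qs: "q = k * of_real s" by (simp add: s_def sum_distrib_left)
  have "cnj q = (\<Sum>i<n. \<Sum>j<n. cnj (v $ j) * of_real (A $$ (j, i)) * v $ i)"
    unfolding q_def cnj_sum using sym by (intro sum.cong refl) simp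
  also have "\<dots> = q" unfolding q_def by (rule sum.swap)
  finally have q: "cnj q = q" .
  have "\<exists>i<n. v $ i \<noteq> 0"
  proof (rule ccontr)
    assume "\<not> ?thesis"
    hence "v = 0\<^sub>v n" using v(1) by (intro eq_vecI) auto
    thus False using v(2) by simp
  qed
  then obtain i where i: "i < n" "v $ i \<noteq> 0" by blast
  have "0 < (cmod (v $ i))\<^sup>2" using i by simp
  also have "\<dots> \<le> s" unfolding s_def using i by (intro member_le_sum) auto
  finally have "s \<noteq> 0" by simp
  with q qs have "cnj k = k" by simp
  then obtain r where r: "k = of_real r" using Reals_cnj_iff Reals_cases by metis
  have "poly (char_poly C) k = 0" using k spectrum_root_char_poly[OF C] by simp
  hence "poly (map_poly complex_of_real (char_poly A)) (of_real r) = 0"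
    unfolding C_def of_real_hom.char_poly_hom[OF A] r .
  hence "complex_of_real (poly (char_poly A) r) = 0"
    unfolding of_real_hom.poly_map_poly .
  hence "poly (char_poly A) r = 0" by simp
  thus ?thesis unfolding spectrum_root_char_poly[OF A] by blast
qed

text \<open>The entrywise absolute value of an eigenvector of the largest eigenvalue: as the matrix
  has nonnegative entries, the triangle inequality turns the eigenvalue equation into the required
  inequality.\<close>

lemma subeigenvector:
  fixes G :: "'a::linorder set \<times> 'a set set"
  assumes fin: "finite (fst G)" "fst G \<noteq> {}" and \<rho>: "0 \<le> r" "r < graph_spectral_radius G"
  obtains \<phi> :: "'a \<Rightarrow> real" where "\<And>x. 0 \<le> \<phi> x" "0 < sum \<phi> (fst G)"
    "\<And>x. x \<in> fst G \<Longrightarrow> r * \<phi> x \<le> sum \<phi> {y\<in>fst G. {x, y} \<in> snd G}"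
proof -
  define V where "V = fst G"
  define n where "n = card V"
  define vs where "vs = sorted_list_of_set V"
  define A where "A = adjacency_matrix G"
  have A: "A \<in> carrier_mat n n"
    by (simp add: A_def adjacency_matrix_def n_def V_def Let_def)
  have Aij: "A $$ (i, j) = of_bool ({vs ! i, vs ! j} \<in> snd G)" if "i < n" "j < n" for i j
    using that by (simp add: A_def adjacency_matrix_def n_def V_def vs_def Let_def)
  have n: "0 < n" using fin by (simp add: n_def V_def card_gt_0_iff)
  have bij: "bij_betw ((!) vs) {..<n} V"
    unfolding vs_def n_def using fin V_def
    by (intro bij_betw_nth) auto
  have "spectrum A \<noteq> {}"
    by (rule symmetric_spectrum_nonempty[OF A n]) (simp add: Aij insert_commute)
  moreover have "finite (spectrum A)" by (rule card_finite_spectrum(1)[OF A])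
  ultimately have "graph_spectral_radius G \<in> spectrum A"
    unfolding graph_spectral_radius_def A_def by (rule Max_in[rotated])
  define k where "k = graph_spectral_radius G"
  obtain v where v: "v \<in> carrier_vec n" "v \<noteq> 0\<^sub>v n" "A *\<^sub>v v = k \<cdot>\<^sub>v v"
    using \<open>graph_spectral_radius G \<in> spectrum A\<close> A
    unfolding k_def spectrum_def eigenvalue_def eigenvector_def by auto
  have row: "(\<Sum>j<n. A $$ (i, j) * v $ j) = k * v $ i" if i: "i < n" for i
  proof -
    have "(A *\<^sub>v v) $ i = (k \<cdot>\<^sub>v v) $ i" using v(3) by simp
    thus ?thesis using i v(1) A by (simp add: scalar_prod_def lessThan_atLeast0)
  qed
  define \<phi> where "\<phi> x = \<bar>v $ (the_inv_into {..<n} ((!) vs) x)\<bar>" for x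
  have \<phi>: "\<phi> (vs ! i) = \<bar>v $ i\<bar>" if "i < n" for i
    using that bij by (simp add: \<phi>_def bij_betw_def the_inv_into_f_f)
  have sum: "sum f V = (\<Sum>i<n. f (vs ! i))" for f :: "'a \<Rightarrow> real"
    using sum.reindex_bij_betw[OF bij, of f] by simp
  show ?thesis
  proof (rule that)
    show "0 \<le> \<phi> x" for x by (simp add: \<phi>_def)
    have "\<exists>i<n. v $ i \<noteq> 0"
    proof (rule ccontr)
      assume "\<not> ?thesis"
      hence "v = 0\<^sub>v n" using v(1) by (intro eq_vecI) auto
      thus False using v(2) by simp
    qed
    then obtain i where i: "i < n" "v $ i \<noteq> 0" by blast
    have "0 < \<bar>v $ i\<bar>" using i by simp
    also have "\<dots> \<le> (\<Sum>i<n. \<bar>v $ i\<bar>)" using i by (intro member_le_sum) auto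
    finally show "0 < sum \<phi> (fst G)" using sum[of \<phi>] \<phi> by (simp add: V_def)
    fix x assume "x \<in> fst G"
    then obtain i where i: "i < n" "x = vs ! i"
      using bij unfolding bij_betw_def V_def by blast
    have "r * \<phi> x \<le> k * \<bar>v $ i\<bar>"
      using \<rho> i by (simp add: \<phi> k_def mult_right_mono)
    also have "\<dots> = \<bar>\<Sum>j<n. A $$ (i, j) * v $ j\<bar>"
      unfolding row[OF i(1)] using \<rho> by (simp add: abs_mult k_def)
    also have "\<dots> \<le> (\<Sum>j<n. \<bar>A $$ (i, j) * v $ j\<bar>)" by (rule sum_abs)
    also have "\<dots> = (\<Sum>j<n. if {x, vs ! j} \<in> snd G then \<phi> (vs ! j) else 0)"
      using i by (intro sum.cong) (auto simp: Aij \<phi> abs_mult)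
    also have "\<dots> = (\<Sum>y\<in>V. if {x, y} \<in> snd G then \<phi> y else 0)"
      by (rule sum[symmetric])
    also have "\<dots> = sum \<phi> {y\<in>fst G. {x, y} \<in> snd G}"
      using fin by (simp add: V_def flip: sum.inter_filter)
    finally show "r * \<phi> x \<le> sum \<phi> {y\<in>fst G. {x, y} \<in> snd G}" .
  qed
qed

text \<open>The vector is extended by 0 to v and scaled to mean 1. The bound 3/2 is the eigenvalue
  inequality with its right-hand side enlarged to the whole sum: 2/3 n \<phi> x \<le> n. It gives
  the bounded summands that concentration requires.\<close>

lemma link_eigenvector:
  fixes H :: "'a::linorder set \<times> 'a set set"
  assumes H: "three_graph H" and fin: "finite (fst H)" and v: "v \<in> fst H" and card: "2 \<le> card (fst H)"
    and c: "2/3 \<le> c" and \<rho>: "c * real (card (fst H)) < graph_spectral_radius (link_graph H v)"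
  obtains \<phi> :: "'a \<Rightarrow> real" where "\<And>x. x \<in> fst H \<Longrightarrow> 0 \<le> \<phi> x" "\<And>x. x \<in> fst H \<Longrightarrow> \<phi> x \<le> 3/2"
    "sum \<phi> (fst H) = real (card (fst H))"
    "\<And>x. x \<in> fst H \<Longrightarrow> c * real (card (fst H)) * \<phi> x \<le> sum \<phi> {y\<in>fst H. {v, x, y} \<in> snd H}"
proof -
  define V where "V = fst H"
  define n where "n = real (card V)"
  have n: "0 < n" using card by (simp add: n_def V_def)
  have finV: "finite V" using fin by (simp add: V_def)
  have ne: "fst (link_graph H v) \<noteq> {}"
  proof
    assume "fst (link_graph H v) = {}"
    hence "fst H \<subseteq> {v}" by (simp add: link_graph_def)
    hence "card (fst H) \<le> 1" using card_mono[of "{v}" "fst H"] by simp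
    thus False using card by simp
  qed
  obtain \<psi> :: "'a \<Rightarrow> real" where \<psi>: "\<And>x. 0 \<le> \<psi> x" "0 < sum \<psi> (V - {v})"
    "\<And>x. x \<in> V - {v} \<Longrightarrow> c * n * \<psi> x \<le> sum \<psi> {y\<in>V - {v}. {x, y} \<in> snd (link_graph H v)}"
    using subeigenvector[of "link_graph H v" "c * n"] \<rho> c n fin ne
    by (auto simp: link_graph_def V_def n_def)
  define s where "s = sum \<psi> (V - {v})"
  define \<phi> where "\<phi> x = (if x = v then 0 else n / s * \<psi> x)" for x
  have s: "0 < s" using \<psi>(2) by (simp add: s_def)
  have \<phi>0: "0 \<le> \<phi> x" for x using n s \<psi>(1) by (simp add: \<phi>_def)
  have \<phi>sum: "sum \<phi> V = n"
  proof -
    have "sum \<phi> V = sum \<phi> (V - {v})"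
      using finV by (intro sum.mono_neutral_right) (auto simp: \<phi>_def)
    also have "\<dots> = n / s * s" unfolding s_def sum_distrib_left by (intro sum.cong) (auto simp: \<phi>_def s_def)
    finally show ?thesis using s by simp
  qed
  have \<phi>eig: "c * n * \<phi> x \<le> sum \<phi> {y\<in>V. {v, x, y} \<in> snd H}" if x: "x \<in> V" for x
  proof (cases "x = v")
    case True
    thus ?thesis using \<phi>0 by (simp add: \<phi>_def sum_nonneg)
  next
    case False
    have sub: "{y\<in>V - {v}. {x, y} \<in> snd (link_graph H v)} \<subseteq> {y\<in>V. {v, x, y} \<in> snd H}"
      by (auto simp: link_graph_def insert_commute)
    have "c * n * \<phi> x = n / s * (c * n * \<psi> x)" using False by (simp add: \<phi>_def)
    also have "\<dots> \<le> n / s * sum \<psi> {y\<in>V - {v}. {x, y} \<in> snd (link_graph H v)}"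
      using \<psi>(3)[of x] x False n s by (intro mult_left_mono) auto
    also have "\<dots> = sum \<phi> {y\<in>V - {v}. {x, y} \<in> snd (link_graph H v)}"
      unfolding sum_distrib_left by (intro sum.cong) (auto simp: \<phi>_def)
    also have "\<dots> \<le> sum \<phi> {y\<in>V. {v, x, y} \<in> snd H}"
      using sub finV \<phi>0 by (intro sum_mono2) auto
    finally show ?thesis .
  qed
  show ?thesis
  proof (rule that)
    show "\<phi> x \<le> 3/2" if "x \<in> fst H" for x
    proof -
      have "2/3 * n * \<phi> x \<le> c * n * \<phi> x" using c n \<phi>0 by (intro mult_right_mono) auto
      also have "\<dots> \<le> sum \<phi> V"
        using \<phi>eig[of x] that sum_mono2[of V "{y\<in>V. {v, x, y} \<in> snd H}" \<phi>] \<phi>0 finV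
        by (fastforce simp: V_def)
      finally show ?thesis using n \<phi>sum by simp
    qed
  qed (use \<phi>0 \<phi>sum \<phi>eig in \<open>auto simp: V_def n_def\<close>)
qed

subsection \<open>Random tuples of triples\<close>

lemma exp_neg_le_quadratic:
  fixes x :: real
  assumes "0 \<le> x"
  shows "exp (- x) \<le> 1 - x + x\<^sup>2 / 2"
proof -
  have pos: "0 < 1 - x + x\<^sup>2 / 2"
    using sum_squares_ge_zero[of "x - 1" 0] by (simp add: power2_eq_square algebra_simps)
  have "(1 - x + x\<^sup>2 / 2) * (1 + x + x\<^sup>2 / 2) = 1 + (x\<^sup>2)\<^sup>2 / 4"
    by (simp add: power2_eq_square algebra_simps)
  hence "1 \<le> (1 - x + x\<^sup>2 / 2) * (1 + x + x\<^sup>2 / 2)" by simp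
  also have "\<dots> \<le> (1 - x + x\<^sup>2 / 2) * exp x"
    using exp_lower_Taylor_quadratic[OF assms] pos by (intro mult_left_mono) auto
  finally show ?thesis by (simp add: exp_minus field_simps)
qed

text \<open>The exponential moment method in counting form, for the lower tail. The range 5
  accommodates a triple of entries of size at most 3/2. The deviation is measured by m, not
  \<open>card C\<close>, so that the same bound applies after a few positions are dropped.\<close>

lemma card_tuples_below_mean:
  fixes f :: "'p \<Rightarrow> real"
  assumes fin: "finite P" "finite C" and card: "card C \<le> m" and f: "\<And>p. p \<in> P \<Longrightarrow> 0 \<le> f p \<and> f p \<le> 5"
    and mean: "\<mu> * real (card P) \<le> sum f P" and \<delta>: "0 < \<delta>"
  shows "real (card {r \<in> (\<Pi>\<^sub>E c\<in>C. P). (\<Sum>c\<in>C. f (r c)) < real (card C) * \<mu> - \<delta> * real m})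
    \<le> real (card P) ^ card C * exp (- (\<delta>\<^sup>2 * real m / 50))"
proof -
  \<comment> \<open>The minimiser of \<open>m * (25 * s\<^sup>2 / 2) - s * \<delta> * m\<close>,
    with minimum \<open>- \<delta>\<^sup>2 * m / 50\<close>.\<close>
  define s where "s = \<delta> / 25"
  have s: "0 < s" using \<delta> by (simp add: s_def)
  define bad where "bad = {r \<in> (\<Pi>\<^sub>E c\<in>C. P). (\<Sum>c\<in>C. f (r c)) < real (card C) * \<mu> - \<delta> * real m}"
  define K where "K = s * (real (card C) * \<mu> - \<delta> * real m)"
  have finT: "finite (\<Pi>\<^sub>E c\<in>C. P)" using fin by (intro finite_PiE) auto
  have "real (card bad) = (\<Sum>r\<in>bad. 1)" by simp
  also have "\<dots> \<le> (\<Sum>r\<in>bad. exp K * (\<Prod>c\<in>C. exp (- (s * f (r c)))))"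
  proof (intro sum_mono)
    fix r assume "r \<in> bad"
    hence "s * (\<Sum>c\<in>C. f (r c)) \<le> K"
      unfolding K_def bad_def using s by (intro mult_left_mono) auto
    hence "1 \<le> exp (K - s * (\<Sum>c\<in>C. f (r c)))" by simp
    also have "\<dots> = exp K * exp (\<Sum>c\<in>C. - (s * f (r c)))"
      by (simp add: exp_diff exp_minus sum_negf sum_distrib_left divide_inverse)
    also have "exp (\<Sum>c\<in>C. - (s * f (r c))) = (\<Prod>c\<in>C. exp (- (s * f (r c))))"
      using fin by (simp add: exp_sum)
    finally show "1 \<le> exp K * (\<Prod>c\<in>C. exp (- (s * f (r c))))" .
  qed
  also have "\<dots> \<le> (\<Sum>r\<in>(\<Pi>\<^sub>E c\<in>C. P). exp K * (\<Prod>c\<in>C. exp (- (s * f (r c)))))"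
    using finT by (intro sum_mono2) (auto simp: bad_def prod_nonneg)
  also have "\<dots> = exp K * (\<Prod>c\<in>C. \<Sum>p\<in>P. exp (- (s * f p)))"
    unfolding sum_distrib_left[symmetric] using fin
    by (subst prod_sum_PiE[of C "\<lambda>_. P" "\<lambda>_ p. exp (- (s * f p))"]) auto
  also have "\<dots> = exp K * (\<Sum>p\<in>P. exp (- (s * f p))) ^ card C" by simp
  also have "\<dots> \<le> exp K * (real (card P) * exp (- s * \<mu> + 25 * s\<^sup>2 / 2)) ^ card C"
  proof (intro mult_left_mono power_mono)
    have "(\<Sum>p\<in>P. exp (- (s * f p))) \<le> (\<Sum>p\<in>P. 1 + 25 * s\<^sup>2 / 2 - s * f p)"
    proof (intro sum_mono)
      fix p assume p: "p \<in> P"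
      have "exp (- (s * f p)) \<le> 1 - s * f p + (s * f p)\<^sup>2 / 2"
        using f[OF p] s by (intro exp_neg_le_quadratic) auto
      moreover have "(s * f p)\<^sup>2 \<le> (s * 5)\<^sup>2" using f[OF p] s by (intro power_mono) auto
      ultimately show "exp (- (s * f p)) \<le> 1 + 25 * s\<^sup>2 / 2 - s * f p"
        by (simp add: power_mult_distrib)
    qed
    also have "\<dots> = real (card P) * (1 + 25 * s\<^sup>2 / 2) - s * sum f P"
      by (simp add: sum_subtractf sum_distrib_left)
    also have "\<dots> \<le> real (card P) * (1 + 25 * s\<^sup>2 / 2) - s * (\<mu> * real (card P))"
      using mean s by simp
    also have "\<dots> = real (card P) * (1 + (- s * \<mu> + 25 * s\<^sup>2 / 2))" by (simp add: algebra_simps)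
    also have "\<dots> \<le> real (card P) * exp (- s * \<mu> + 25 * s\<^sup>2 / 2)"
      by (intro mult_left_mono exp_ge_add_one_self) auto
    finally show "(\<Sum>p\<in>P. exp (- (s * f p))) \<le> real (card P) * exp (- s * \<mu> + 25 * s\<^sup>2 / 2)" .
  qed (auto simp: sum_nonneg)
  also have "\<dots> = real (card P) ^ card C * exp (K + real (card C) * (- s * \<mu> + 25 * s\<^sup>2 / 2))"
    by (simp add: power_mult_distrib exp_add exp_of_nat_mult)
  also have "\<dots> \<le> real (card P) ^ card C * exp (- (\<delta>\<^sup>2 * real m / 50))"
  proof (intro mult_left_mono)
    have "K + real (card C) * (- s * \<mu> + 25 * s\<^sup>2 / 2) = real (card C) * (25 * s\<^sup>2 / 2) - s * \<delta> * real m"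
      by (simp add: K_def algebra_simps)
    also have "\<dots> \<le> real m * (25 * s\<^sup>2 / 2) - s * \<delta> * real m"
      using card by (intro diff_right_mono mult_right_mono) auto
    also have "\<dots> = - (\<delta>\<^sup>2 * real m / 50)" by (simp add: s_def power2_eq_square)
    finally show "exp (K + real (card C) * (- s * \<mu> + 25 * s\<^sup>2 / 2)) \<le> exp (- (\<delta>\<^sup>2 * real m / 50))"
      by simp
  qed simp
  finally show ?thesis unfolding bad_def .
qed

text \<open>The function and its mean may depend on the entries with index in \<open>A\<close>.\<close>

lemma card_tuples_below_conditional_mean:
  fixes g :: "('i \<Rightarrow> 'p) \<Rightarrow> 'p \<Rightarrow> real"
  assumes fin: "finite P" "finite I" and A: "A \<subseteq> I" and card: "card I \<le> m"
    and g: "\<And>q p. q \<in> (\<Pi>\<^sub>E a\<in>A. P) \<Longrightarrow> p \<in> P \<Longrightarrow> 0 \<le> g q p \<and> g q p \<le> 5"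
    and mean: "\<And>q. q \<in> (\<Pi>\<^sub>E a\<in>A. P) \<Longrightarrow> \<mu> q * real (card P) \<le> sum (g q) P" and \<delta>: "0 < \<delta>"
  shows "real (card {r \<in> (\<Pi>\<^sub>E c\<in>I. P). (\<Sum>c\<in>I - A. g (restrict r A) (r c))
      < real (card (I - A)) * \<mu> (restrict r A) - \<delta> * real m})
    \<le> real (card P) ^ card I * exp (- (\<delta>\<^sup>2 * real m / 50))"
proof -
  define \<epsilon> where "\<epsilon> = exp (- (\<delta>\<^sup>2 * real m / 50))"
  define B where "B q = {r \<in> (\<Pi>\<^sub>E c\<in>I - A. P). (\<Sum>c\<in>I - A. g q (r c))
      < real (card (I - A)) * \<mu> q - \<delta> * real m}" for q
  define bad where "bad = {r \<in> (\<Pi>\<^sub>E c\<in>I. P). (\<Sum>c\<in>I - A. g (restrict r A) (r c))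
      < real (card (I - A)) * \<mu> (restrict r A) - \<delta> * real m}"
  have finA: "finite A" using A fin finite_subset by blast
  have finQ: "finite (\<Pi>\<^sub>E a\<in>A. P)" using fin finA by (intro finite_PiE) auto
  have finB: "finite (B q)" for q
    unfolding B_def using fin by (simp add: finite_PiE)
  have B: "real (card (B q)) \<le> real (card P) ^ card (I - A) * \<epsilon>" if "q \<in> (\<Pi>\<^sub>E a\<in>A. P)" for q
    unfolding B_def \<epsilon>_def
  proof (rule card_tuples_below_mean)
    show "card (I - A) \<le> m" using card card_mono[of I "I - A"] fin by auto
  qed (use fin g[OF that] mean[OF that] \<delta> in auto)
  \<comment> \<open>A tuple is encoded by its restrictions to A and to the rest; once the first is
    fixed, so are function and mean, and the unconditional bound applies to the second.\<close>
  have "card bad \<le> card (Sigma (\<Pi>\<^sub>E a\<in>A. P) B)"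
  proof (rule card_inj_on_le)
    show "inj_on (\<lambda>r. (restrict r A, restrict r (I - A))) bad"
    proof (rule inj_onI)
      fix r r' assume r: "r \<in> bad" "r' \<in> bad"
        and eq: "(restrict r A, restrict r (I - A)) = (restrict r' A, restrict r' (I - A))"
      show "r = r'"
      proof
        fix c
        note eq' = eq[unfolded prod.inject]
        have "restrict r A c = restrict r' A c" "restrict r (I - A) c = restrict r' (I - A) c"
          using fun_cong[OF conjunct1[OF eq']] fun_cong[OF conjunct2[OF eq']] .
        moreover have "c \<notin> I \<Longrightarrow> r c = r' c"
          using r unfolding bad_def by (metis (no_types, lifting) PiE_arb mem_Collect_eq)
        ultimately show "r c = r' c" by (cases "c \<in> I"; cases "c \<in> A") simp_all
      qed
    qed
    show "(\<lambda>r. (restrict r A, restrict r (I - A))) ` bad \<subseteq> Sigma (\<Pi>\<^sub>E a\<in>A. P) B"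
      using A by (auto simp: bad_def B_def PiE_mem subset_iff)
    show "finite (Sigma (\<Pi>\<^sub>E a\<in>A. P) B)" using finQ finB by blast
  qed
  hence "real (card bad) \<le> (\<Sum>q\<in>(\<Pi>\<^sub>E a\<in>A. P). real (card (B q)))"
    using finQ finB by (simp flip: of_nat_sum)
  also have "\<dots> \<le> real (card (\<Pi>\<^sub>E a\<in>A. P)) * (real (card P) ^ card (I - A) * \<epsilon>)"
    using B by (intro sum_bounded_above) auto
  also have "\<dots> = real (card P) ^ (card A + card (I - A)) * \<epsilon>"
    using finA by (simp add: card_PiE power_add)
  also have "card A + card (I - A) = card I"
    using A fin finA card_Diff_subset[of A I] card_mono[of I A] by simp
  finally show ?thesis unfolding bad_def \<epsilon>_def .
qed

text \<open>\<open>V\<close> is partitioned into the triples \<open>p \<in> P\<close> with vertices \<open>vt p 0\<close>, \<open>vt p 1\<close>, \<open>vt p 2\<close>, and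
  \<open>\<phi> x\<close> is a nonnegative subeigenvector of mean 1 of the link of \<open>x\<close>. For a tuple \<open>r\<close> of \<open>m\<close>
  triples, the label \<open>(a, k)\<close> stands for the \<open>k\<close>-th vertex of the \<open>a\<close>-th triple, where the
  \<open>m\<close>-th triple is always \<open>p0\<close>.\<close>

locale triple_sampling =
  fixes P :: "'p set" and vt :: "'p \<Rightarrow> nat \<Rightarrow> 'v" and V :: "'v set" and E :: "'v set set"
    and \<phi> :: "'v \<Rightarrow> 'v \<Rightarrow> real" and \<gamma> :: real and m :: nat and p0 :: 'p
  assumes finP: "finite P" and p0: "p0 \<in> P" and \<gamma>: "0 < \<gamma>" "\<gamma> < 1/3" and m: "5 \<le> \<gamma>/100 * real m"
    and finV: "finite V"
    and vt: "\<And>p k. p \<in> P \<Longrightarrow> k < 3 \<Longrightarrow> vt p k \<in> V"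
    and sum_vt: "\<And>h :: 'v \<Rightarrow> real. (\<Sum>p\<in>P. \<Sum>k<3. h (vt p k)) = sum h V"
    and \<phi>: "\<And>x y. x \<in> V \<Longrightarrow> y \<in> V \<Longrightarrow> 0 \<le> \<phi> x y \<and> \<phi> x y \<le> 3/2"
    and \<phi>_sum: "\<And>x. x \<in> V \<Longrightarrow> sum (\<phi> x) V = 3 * real (card P)"
    and \<phi>_eig: "\<And>x y. x \<in> V \<Longrightarrow> y \<in> V \<Longrightarrow>
      (2/3 + \<gamma>) * (3 * real (card P)) * \<phi> x y \<le> sum (\<phi> x) {z\<in>V. {x, y, z} \<in> E}"
begin

definition vert :: "(nat \<Rightarrow> 'p) \<Rightarrow> nat \<times> nat \<Rightarrow> 'v" where
  "vert r = (\<lambda>(a, k). vt ((r(m := p0)) a) k)"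

definition \<Lambda> :: "(nat \<times> nat) set" where "\<Lambda> = {..<m} \<times> {..<3}"

definition L :: "(nat \<times> nat) set" where "L = {..m} \<times> {..<3}"

text \<open>Edges with two labels at the same position are left out: in a blow-up such labels may be
  realised by two different triples of one part, whereas a tuple contains only one triple per
  position.\<close>

definition ltype :: "(nat \<Rightarrow> 'p) \<Rightarrow> (nat \<times> nat) set set" where
  "ltype r = {e. e \<subseteq> L \<and> card e = 3 \<and> inj_on fst e \<and> vert r ` e \<in> E}"

definition T :: "(nat \<Rightarrow> 'p) set" where "T = (\<Pi>\<^sub>E c\<in>{..<m}. P)"

definition mass :: "'v \<Rightarrow> 'p \<Rightarrow> real" where
  "mass x p = (\<Sum>k<3. \<phi> x (vt p k))"

definition nmass :: "'v \<Rightarrow> 'v \<Rightarrow> 'p \<Rightarrow> real" where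
  "nmass x y p = (\<Sum>k<3. if {x, y, vt p k} \<in> E then \<phi> x (vt p k) else 0)"

definition bad1 :: "nat \<times> nat \<Rightarrow> (nat \<Rightarrow> 'p) set" where
  "bad1 v = {r\<in>T. (\<Sum>c\<in>{..<m} - {fst v}. mass (vert r v) (r c))
     < real (card ({..<m} - {fst v})) * 3 - \<gamma>/100 * real m}"

text \<open>The positions of v and i are dropped because they determine the two vertices. Once these
  are fixed, the summands at the other positions are independent, with mean at least
  \<open>3 * (2/3 + \<gamma>) * \<phi> (vert r v) (vert r i)\<close> by
  \<open>\<phi>_eig\<close>.\<close>

definition bad2 :: "nat \<times> nat \<Rightarrow> nat \<times> nat \<Rightarrow> (nat \<Rightarrow> 'p) set" where
  "bad2 v i = {r\<in>T. (\<Sum>c\<in>{..<m} - {fst v, fst i}. nmass (vert r v) (vert r i) (r c))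
     < real (card ({..<m} - {fst v, fst i})) * (3 * (2/3 + \<gamma>) * \<phi> (vert r v) (vert r i)) - \<gamma>/100 * real m}"

lemma vert_V:
  assumes "r \<in> T" "v \<in> L"
  shows "vert r v \<in> V"
proof -
  obtain a k where v: "v = (a, k)" "a \<le> m" "k < 3" using assms(2) by (auto simp: L_def)
  have "(r(m := p0)) a \<in> P"
    using p0 v(2) PiE_mem[OF assms(1)[unfolded T_def], of a] by auto
  thus ?thesis using vt v by (simp add: vert_def)
qed

lemma \<Lambda>_L: "\<Lambda> \<subseteq> L"
  by (auto simp: \<Lambda>_def L_def)

lemma card_\<Lambda>: "card \<Lambda> = 3 * m"
  by (simp add: \<Lambda>_def)

lemma m_pos: "0 < m"
proof (rule ccontr)
  assume "\<not> 0 < m"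
  thus False using m by simp
qed

lemma rich_typical:
  assumes r: "r \<in> T" and v: "v \<in> L" and 1: "r \<notin> bad1 v" and 2: "\<And>i. i \<in> \<Lambda> \<Longrightarrow> r \<notin> bad2 v i"
  shows "rich \<gamma> \<Lambda> (ltype r) v"
proof -
  define x where "x = vert r v"
  \<comment> \<open>Zero at the position of v itself: no edge of the type has two labels there, so
    the inequality for such i must have a nonpositive left-hand side.\<close>
  define f where "f i = (if fst i = fst v then 0 else \<phi> x (vert r i))" for i
  have x: "x \<in> V" using vert_V[OF r v] by (simp add: x_def)
  have f0: "0 \<le> f i" if "i \<in> L" for i using \<phi>[OF x vert_V[OF r that]] by (simp add: f_def)
  have rP: "r c \<in> P" if "c < m" for c using r that by (auto simp: T_def PiE_mem)
  have vert_r: "vert r (c, k) = vt (r c) k" if "c < m" for c k using that by (simp add: vert_def)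
  have sum\<Lambda>: "sum h \<Lambda> = (\<Sum>c<m. \<Sum>k<3. h (c, k))" for h :: "nat \<times> nat \<Rightarrow> real"
    by (simp add: \<Lambda>_def sum.cartesian_product)
  show ?thesis unfolding rich_def
  proof (intro exI[of _ f] conjI ballI)
    fix i assume "i \<in> \<Lambda>"
    thus "0 \<le> f i" using f0 \<Lambda>_L by blast
  next
    have "real m - 1 \<le> real (card ({..<m} - {fst v}))"
      using diff_card_le_card_Diff[of "{fst v}" "{..<m}"] m_pos by simp
    hence "(1 - \<gamma>/100) * real (card \<Lambda>) \<le> real (card ({..<m} - {fst v})) * 3 - \<gamma>/100 * real m"
      using m by (simp add: card_\<Lambda> algebra_simps)
    also have "\<dots> \<le> (\<Sum>c\<in>{..<m} - {fst v}. mass x (r c))"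
      using 1 r by (simp add: bad1_def x_def)
    also have "\<dots> = (\<Sum>c\<in>{..<m} - {fst v}. \<Sum>k<3. f (c, k))"
      by (intro sum.cong refl) (auto simp: mass_def f_def vert_r)
    also have "\<dots> \<le> sum f \<Lambda>" unfolding sum\<Lambda> using f0
      by (intro sum_mono2 sum_nonneg) (auto simp: L_def)
    finally show "(1 - \<gamma>/100) * real (card \<Lambda>) \<le> sum f \<Lambda>" .
  next
    fix i assume i: "i \<in> \<Lambda>"
    have rhs0: "0 \<le> sum f {j\<in>\<Lambda>. {v, i, j} \<in> ltype r}"
      using f0 \<Lambda>_L by (intro sum_nonneg) auto
    show "(2/3 + \<gamma>) * real (card \<Lambda>) * f i - \<gamma>/100 * real (card \<Lambda>)
        \<le> sum f {j\<in>\<Lambda>. {v, i, j} \<in> ltype r}"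
    proof (cases "fst i = fst v")
      case True
      hence "f i = 0" by (simp add: f_def)
      moreover have "0 \<le> \<gamma>/100 * real (card \<Lambda>)" using \<gamma> by simp
      ultimately show ?thesis using rhs0 by simp
    next
      case False
      define y where "y = vert r i"
      define M where "M = {..<m} - {fst v, fst i}"
      have iL: "i \<in> L" using i \<Lambda>_L by blast
      have y: "y \<in> V" using vert_V[OF r iL] by (simp add: y_def)
      have fi: "f i = \<phi> x y" using False by (simp add: f_def y_def)
      have "card {fst v, fst i} \<le> 2" using card_insert_le_m1[of 2 "{fst i}"] by simp
      hence M: "real m - 2 \<le> real (card M)"
        using diff_card_le_card_Diff[of "{fst v, fst i}" "{..<m}"] unfolding M_def by simp
      \<comment> \<open>Dropping two positions costs at most 2 * 3 * 3/2 = 9, covered by the spare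
        error \<open>2 * (\<gamma>/100 * m)\<close>, which is at least 10 by the assumption on
        m.\<close>
      have "(2/3 + \<gamma>) * \<phi> x y \<le> 1 * (3/2)"
        using \<gamma> \<phi>[OF x y] by (intro mult_mono) auto
      hence "(2/3 + \<gamma>) * real (card \<Lambda>) * f i - \<gamma>/100 * real (card \<Lambda>)
          \<le> (real m - 2) * (3 * ((2/3 + \<gamma>) * \<phi> x y)) - \<gamma>/100 * real m"
        unfolding card_\<Lambda> fi using m by (simp add: algebra_simps)
      also have "\<dots> \<le> real (card M) * (3 * ((2/3 + \<gamma>) * \<phi> x y)) - \<gamma>/100 * real m"
        using M \<gamma> \<phi>[OF x y] by (intro diff_right_mono mult_right_mono) auto
      also have "\<dots> \<le> (\<Sum>c\<in>M. nmass x y (r c))"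
        using 2[OF i] r unfolding bad2_def x_def y_def M_def mem_Collect_eq mult.assoc
        by (simp only: not_less simp_thms)
      also have "\<dots> = (\<Sum>c\<in>M. \<Sum>k<3. if {v, i, (c, k)} \<in> ltype r then f (c, k) else 0)"
        unfolding nmass_def
      proof (intro sum.cong refl)
        fix c k assume c: "c \<in> M" and k: "k \<in> {..<3::nat}"
        have d: "v \<noteq> i" "v \<noteq> (c, k)" "i \<noteq> (c, k)" "c \<noteq> fst v" "c \<noteq> fst i" "c < m"
          using c False by (auto simp: M_def)
        have "inj_on fst {v, i, (c, k)}" using d False by (auto simp: inj_on_def)
        moreover have "(c, k) \<in> L" using d k by (simp add: L_def)
        moreover have "vert r ` {v, i, (c, k)} = {x, y, vt (r c) k}"
          using vert_r[OF d(6)] by (simp add: x_def y_def)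
        ultimately have "{v, i, (c, k)} \<in> ltype r \<longleftrightarrow> {x, y, vt (r c) k} \<in> E"
          unfolding ltype_def mem_Collect_eq using d v iL by simp
        thus "(if {x, y, vt (r c) k} \<in> E then \<phi> x (vt (r c) k) else 0)
            = (if {v, i, (c, k)} \<in> ltype r then f (c, k) else 0)"
          using d vert_r by (simp add: f_def)
      qed
      also have "\<dots> \<le> (\<Sum>c<m. \<Sum>k<3. if {v, i, (c, k)} \<in> ltype r then f (c, k) else 0)"
        using f0 by (intro sum_mono2 sum_nonneg) (auto simp: M_def L_def)
      also have "\<dots> = (\<Sum>j\<in>\<Lambda>. if {v, i, j} \<in> ltype r then f j else 0)"
        by (rule sum\<Lambda>[symmetric])
      also have "\<dots> = sum f {j\<in>\<Lambda>. {v, i, j} \<in> ltype r}"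
        by (subst sum.inter_filter) (auto simp: \<Lambda>_def)
      finally show ?thesis .
    qed
  qed
qed

lemma vert_restrict: "fst v \<in> A \<or> fst v = m \<Longrightarrow> vert (restrict r A) v = vert r v"
  by (cases v) (auto simp: vert_def)

lemma vert_partial:
  assumes "q \<in> (\<Pi>\<^sub>E a\<in>A. P)" "v \<in> L" "fst v \<in> A \<or> fst v = m"
  shows "vert q v \<in> V"
  using assms p0 vt by (cases v) (auto simp: vert_def L_def PiE_mem)

lemma card_bad1:
  assumes v: "v \<in> L"
  shows "real (card (bad1 v)) \<le> real (card P) ^ m * exp (- ((\<gamma>/100)\<^sup>2 * real m / 50))"
proof -
  \<comment> \<open>The sampled positions on which \<open>vert r v\<close> depends; empty if v is a
    label of \<open>p0\<close>.\<close>
  define A where "A = {..<m} \<inter> {fst v}"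
  have D: "{..<m} - A = {..<m} - {fst v}" by (auto simp: A_def)
  have inA: "fst v \<in> A \<or> fst v = m" using v by (auto simp: A_def L_def)
  have x: "vert q v \<in> V" if "q \<in> (\<Pi>\<^sub>E a\<in>A. P)" for q
    using vert_partial[OF that v inA] .
  have "real (card {r \<in> (\<Pi>\<^sub>E c\<in>{..<m}. P). (\<Sum>c\<in>{..<m} - A. mass (vert (restrict r A) v) (r c))
      < real (card ({..<m} - A)) * 3 - \<gamma>/100 * real m})
    \<le> real (card P) ^ card {..<m} * exp (- ((\<gamma>/100)\<^sup>2 * real m / 50))"
  proof (rule card_tuples_below_conditional_mean[where \<mu> = "\<lambda>_. 3" and g = "\<lambda>q. mass (vert q v)"])
    fix q p assume q: "q \<in> (\<Pi>\<^sub>E a\<in>A. P)" and p: "p \<in> P"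
    have "0 \<le> \<phi> (vert q v) (vt p k) \<and> \<phi> (vert q v) (vt p k) \<le> 3/2" if "k \<in> {..<3}" for k
      using \<phi>[OF x[OF q] vt[OF p]] that by auto
    thus "0 \<le> mass (vert q v) p \<and> mass (vert q v) p \<le> 5"
      using sum_bounded_above[of "{..<3::nat}" "\<lambda>k. \<phi> (vert q v) (vt p k)" "3/2"]
      by (auto simp: mass_def intro!: sum_nonneg)
  next
    fix q assume q: "q \<in> (\<Pi>\<^sub>E a\<in>A. P)"
    show "3 * real (card P) \<le> sum (mass (vert q v)) P"
      unfolding mass_def sum_vt using \<phi>_sum[OF x[OF q]] by simp
  qed (use finP \<gamma> in \<open>auto simp: A_def\<close>)
  thus ?thesis unfolding D vert_restrict[OF inA] by (simp add: bad1_def T_def)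
qed

lemma card_bad2:
  assumes v: "v \<in> L" and i: "i \<in> \<Lambda>"
  shows "real (card (bad2 v i)) \<le> real (card P) ^ m * exp (- ((\<gamma>/100)\<^sup>2 * real m / 50))"
proof -
  define A where "A = {..<m} \<inter> {fst v, fst i}"
  define \<mu> where "\<mu> q = 3 * (2/3 + \<gamma>) * \<phi> (vert q v) (vert q i)" for q
  have D: "{..<m} - A = {..<m} - {fst v, fst i}" by (auto simp: A_def)
  have iL: "i \<in> L" using i \<Lambda>_L by blast
  have vA: "fst v \<in> A \<or> fst v = m" and iA: "fst i \<in> A \<or> fst i = m"
    using v i by (auto simp: A_def L_def \<Lambda>_def)
  have x: "vert q v \<in> V" and y: "vert q i \<in> V" if "q \<in> (\<Pi>\<^sub>E a\<in>A. P)" for q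
    using vert_partial[OF that v vA] vert_partial[OF that iL iA] .
  have "real (card {r \<in> (\<Pi>\<^sub>E c\<in>{..<m}. P).
      (\<Sum>c\<in>{..<m} - A. nmass (vert (restrict r A) v) (vert (restrict r A) i) (r c))
      < real (card ({..<m} - A)) * \<mu> (restrict r A) - \<gamma>/100 * real m})
    \<le> real (card P) ^ card {..<m} * exp (- ((\<gamma>/100)\<^sup>2 * real m / 50))"
  proof (rule card_tuples_below_conditional_mean[where g = "\<lambda>q. nmass (vert q v) (vert q i)"])
    fix q p assume q: "q \<in> (\<Pi>\<^sub>E a\<in>A. P)" and p: "p \<in> P"
    define h where "h k = (if {vert q v, vert q i, vt p k} \<in> E then \<phi> (vert q v) (vt p k) else 0)" for k
    have "0 \<le> h k \<and> h k \<le> 3/2" if "k \<in> {..<3}" for k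
      using \<phi>[OF x[OF q] vt[OF p]] that by (auto simp: h_def)
    hence "0 \<le> sum h {..<3} \<and> sum h {..<3} \<le> 5"
      using sum_bounded_above[of "{..<3::nat}" h "3/2"] by (auto intro!: sum_nonneg)
    thus "0 \<le> nmass (vert q v) (vert q i) p \<and> nmass (vert q v) (vert q i) p \<le> 5"
      unfolding nmass_def h_def .
  next
    fix q assume q: "q \<in> (\<Pi>\<^sub>E a\<in>A. P)"
    have "\<mu> q * real (card P) = (2/3 + \<gamma>) * (3 * real (card P)) * \<phi> (vert q v) (vert q i)"
      by (simp add: \<mu>_def)
    also have "\<dots> \<le> sum (\<phi> (vert q v)) {z\<in>V. {vert q v, vert q i, z} \<in> E}"
      by (rule \<phi>_eig[OF x[OF q] y[OF q]])
    also have "\<dots> = sum (nmass (vert q v) (vert q i)) P"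
      unfolding nmass_def
      by (subst sum_vt[of "\<lambda>z. if {vert q v, vert q i, z} \<in> E then \<phi> (vert q v) z else 0"])
        (use finV in \<open>simp flip: sum.inter_filter\<close>)
    finally show "\<mu> q * real (card P) \<le> sum (nmass (vert q v) (vert q i)) P" .
  qed (use finP \<gamma> in \<open>auto simp: A_def\<close>)
  thus ?thesis unfolding D \<mu>_def vert_restrict[OF vA] vert_restrict[OF iA]
    by (simp add: bad2_def T_def)
qed

lemma card_not_rich:
  "real (card {r\<in>T. \<not> (\<forall>v\<in>L. rich \<gamma> \<Lambda> (ltype r) v)})
    \<le> real (card P) ^ m * ((3 * real m + 3)\<^sup>2 * exp (- ((\<gamma>/100)\<^sup>2 * real m / 50)))"
proof -
  define \<epsilon> where "\<epsilon> = real (card P) ^ m * exp (- ((\<gamma>/100)\<^sup>2 * real m / 50))"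
  have \<epsilon>: "0 \<le> \<epsilon>" by (simp add: \<epsilon>_def)
  have finT: "finite T" unfolding T_def using finP by (intro finite_PiE) auto
  have finL: "finite L" "finite \<Lambda>" by (simp_all add: L_def \<Lambda>_def)
  define B where "B v = bad1 v \<union> (\<Union>i\<in>\<Lambda>. bad2 v i)" for v
  have finB: "finite (B v)" for v
    using finT finite_subset[of "B v" T] by (auto simp: B_def bad1_def bad2_def)
  have B: "real (card (B v)) \<le> (3 * real m + 1) * \<epsilon>" if v: "v \<in> L" for v
  proof -
    have "card (B v) \<le> card (bad1 v) + card (\<Union>i\<in>\<Lambda>. bad2 v i)"
      unfolding B_def by (rule card_Un_le)
    also have "\<dots> \<le> card (bad1 v) + (\<Sum>i\<in>\<Lambda>. card (bad2 v i))"
      using card_UN_le[OF finL(2)] by simp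
    finally have "real (card (B v)) \<le> real (card (bad1 v)) + (\<Sum>i\<in>\<Lambda>. real (card (bad2 v i)))"
      by (simp flip: of_nat_sum of_nat_add)
    also have "\<dots> \<le> \<epsilon> + real (card \<Lambda>) * \<epsilon>"
      using card_bad1[OF v] card_bad2[OF v] unfolding \<epsilon>_def by (intro add_mono sum_bounded_above)
    finally show ?thesis by (simp add: card_\<Lambda> algebra_simps)
  qed
  have "{r\<in>T. \<not> (\<forall>v\<in>L. rich \<gamma> \<Lambda> (ltype r) v)} \<subseteq> (\<Union>v\<in>L. B v)"
  proof
    fix r assume "r \<in> {r\<in>T. \<not> (\<forall>v\<in>L. rich \<gamma> \<Lambda> (ltype r) v)}"
    then obtain v where "r \<in> T" "v \<in> L" "\<not> rich \<gamma> \<Lambda> (ltype r) v" by blast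
    thus "r \<in> (\<Union>v\<in>L. B v)" using rich_typical[of r v] unfolding B_def by blast
  qed
  hence "card {r\<in>T. \<not> (\<forall>v\<in>L. rich \<gamma> \<Lambda> (ltype r) v)} \<le> card (\<Union>v\<in>L. B v)"
    using finL finB by (intro card_mono) auto
  also have "\<dots> \<le> (\<Sum>v\<in>L. card (B v))" by (rule card_UN_le[OF finL(1)])
  finally have "real (card {r\<in>T. \<not> (\<forall>v\<in>L. rich \<gamma> \<Lambda> (ltype r) v)}) \<le> (\<Sum>v\<in>L. real (card (B v)))"
    by (simp flip: of_nat_sum)
  also have "\<dots> \<le> real (card L) * ((3 * real m + 1) * \<epsilon>)"
    using B by (intro sum_bounded_above)
  also have "\<dots> \<le> (3 * real m + 3) * ((3 * real m + 3) * \<epsilon>)"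
    using \<epsilon> by (intro mult_mono) (auto simp: L_def)
  finally show ?thesis by (simp add: \<epsilon>_def power2_eq_square algebra_simps)
qed

end

section \<open>Exchanging triples through a popular type\<close>

definition matching_weight :: "'l set \<Rightarrow> 'l set \<Rightarrow> 'l set set \<Rightarrow> nat \<Rightarrow> ('l set \<Rightarrow> nat) \<Rightarrow> bool" where
  "matching_weight \<Lambda> U F D z \<longleftrightarrow> (\<forall>x\<in>\<Lambda>. (\<Sum>e\<in>F. z e * of_bool (x \<in> e)) = D) \<and>
     (\<forall>x\<in>U. (\<Sum>e\<in>F. z e * of_bool (x \<in> e)) = 1)"

text \<open>The part size in Erdos' theorem must be fixed before the hypergraph is known. On fixed
  \<Lambda> and U there are only finitely many systems, so the sum of their degrees D is a common
  bound.\<close>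

lemma bounded_matching_weight:
  assumes "finite \<Lambda>" "finite U"
  obtains s where "\<And>F. rich_system \<gamma> \<Lambda> U F \<Longrightarrow> \<exists>D z. D \<le> s \<and> matching_weight \<Lambda> U F D z"
proof -
  define R where "R = {F. rich_system \<gamma> \<Lambda> U F}"
  have "R \<subseteq> Pow (Pow (\<Lambda> \<union> U))"
    using rich_system.edge unfolding R_def by fastforce
  hence finR: "finite R" using assms finite_subset by blast
  have "\<forall>F\<in>R. \<exists>D. \<exists>z. matching_weight \<Lambda> U F D z"
  proof
    fix F assume "F \<in> R"
    then interpret rich_system \<gamma> \<Lambda> U F by (simp add: R_def)
    show "\<exists>D. \<exists>z. matching_weight \<Lambda> U F D z"
      using integral_matching unfolding matching_weight_def by metis
  qed
  then obtain D where D: "\<forall>F\<in>R. \<exists>z. matching_weight \<Lambda> U F (D F) z"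
    by (rule bchoice[THEN exE])
  show ?thesis
  proof (rule that)
    fix F assume "rich_system \<gamma> \<Lambda> U F"
    hence F: "F \<in> R" by (simp add: R_def)
    have "D F \<le> (\<Sum>F\<in>R. D F)" using finR F by (intro member_le_sum) auto
    thus "\<exists>Da z. Da \<le> (\<Sum>F\<in>R. D F) \<and> matching_weight \<Lambda> U F Da z" using D F by blast
  qed
qed

context triple_sampling begin

text \<open>At least half of the tuples have rich types, and there are at most
  \<open>2 ^ (2 ^ card L)\<close> types; the factor 4 instead of 2 leaves room for a strict
  inequality.\<close>

lemma popular_type:
  assumes small: "(3 * real m + 3)\<^sup>2 * exp (- ((\<gamma>/100)\<^sup>2 * real m / 50)) \<le> 1/2"
  obtains F where "1 / (4 * 2 ^ (2 ^ card L)) * real (card P) ^ m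
      \<le> real (card {r\<in>T. (\<forall>v\<in>L. rich \<gamma> \<Lambda> F v) \<and> ltype r = F})"
proof -
  define N where "N = real (card P)"
  have "card P \<noteq> 0" using finP p0 by auto
  hence Nm: "0 < N ^ m" by (simp add: N_def)
  have finT: "finite T" unfolding T_def using finP by (intro finite_PiE) auto
  have cardT: "real (card T) = N ^ m" unfolding T_def N_def by (simp add: card_PiE)
  define G where "G = {r\<in>T. \<forall>v\<in>L. rich \<gamma> \<Lambda> (ltype r) v}"
  define B where "B = {r\<in>T. \<not> (\<forall>v\<in>L. rich \<gamma> \<Lambda> (ltype r) v)}"
  have "T = G \<union> B" by (auto simp: G_def B_def)
  hence "card T \<le> card G + card B" using card_Un_le by metis
  moreover have "real (card B) \<le> N ^ m * (1/2)"
    using card_not_rich mult_left_mono[OF small, of "N ^ m"] Nm unfolding B_def N_def by linarith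
  ultimately have G: "N ^ m / 2 \<le> real (card G)" using cardT by linarith
  define C where "C F = {r\<in>T. (\<forall>v\<in>L. rich \<gamma> \<Lambda> F v) \<and> ltype r = F}" for F
  define K where "K = (2::real) ^ (2 ^ card L)"
  have finL: "finite L" by (simp add: L_def)
  have "\<exists>F. 1 / (4 * K) * N ^ m \<le> real (card (C F))"
  proof (rule ccontr)
    assume neg: "\<not> ?thesis"
    have "G \<subseteq> (\<Union>F\<in>Pow (Pow L). C F)" by (auto simp: G_def C_def ltype_def)
    hence "card G \<le> card (\<Union>F\<in>Pow (Pow L). C F)"
      using finT finL by (intro card_mono) (auto simp: C_def)
    also have "\<dots> \<le> (\<Sum>F\<in>Pow (Pow L). card (C F))" using finL by (intro card_UN_le) auto
    finally have "real (card G) \<le> (\<Sum>F\<in>Pow (Pow L). real (card (C F)))"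
      by (simp flip: of_nat_sum)
    also have "\<dots> \<le> real (card (Pow (Pow L))) * (1 / (4 * K) * N ^ m)"
      using neg by (intro sum_bounded_above) (auto simp: not_le less_imp_le)
    also have "\<dots> = N ^ m / 4" using finL by (simp add: card_Pow K_def)
    finally show False using G Nm by linarith
  qed
  thus ?thesis using that unfolding C_def N_def K_def by blast
qed

lemma rich_system_type:
  assumes "\<forall>v\<in>L. rich \<gamma> \<Lambda> (ltype r) v"
  shows "rich_system \<gamma> \<Lambda> ({m} \<times> {..<3}) (ltype r)"
proof
  show "\<Lambda> \<noteq> {}" using m_pos by (auto simp: \<Lambda>_def lessThan_empty_iff)
  have L: "\<Lambda> \<union> {m} \<times> {..<3} = L" by (auto simp: \<Lambda>_def L_def)
  show "e \<subseteq> \<Lambda> \<union> {m} \<times> {..<3} \<and> card e = 3" if "e \<in> ltype r" for e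
    using that unfolding L by (simp add: ltype_def)
  show "rich \<gamma> \<Lambda> (ltype r) v" if "v \<in> \<Lambda> \<union> {m} \<times> {..<3}" for v
    using that assms unfolding L by blast
qed (use \<gamma> in \<open>auto simp: \<Lambda>_def\<close>)

text \<open>Label \<open>(a, k)\<close> is blown up to the k-th vertices of D triples from
  \<open>S a\<close>, and \<open>(m, k)\<close> to the k-th vertex of \<open>p0\<close>. The three
  labels of a position use the same triples, so the matching covers exactly the union of these
  triples.\<close>

lemma augmentation:
  assumes small: "(3 * real m + 3)\<^sup>2 * exp (- ((\<gamma>/100)\<^sup>2 * real m / 50)) \<le> 1/2"
    and weight: "\<And>F. rich_system \<gamma> \<Lambda> ({m} \<times> {..<3}) F \<Longrightarrow>
      \<exists>D z. D \<le> s \<and> matching_weight \<Lambda> ({m} \<times> {..<3}) F D z"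
    and complete: "\<And>T'. T' \<subseteq> T \<Longrightarrow> 1 / (4 * 2 ^ (2 ^ card L)) * real (card P) ^ m \<le> real (card T') \<Longrightarrow>
      \<exists>S. (\<forall>i<m. S i \<subseteq> P - {p0} \<and> card (S i) = Suc s) \<and> disjoint_family_on S {..<m} \<and>
        (\<Pi>\<^sub>E i\<in>{..<m}. S i) \<subseteq> T'"
    and inj: "inj_on (\<lambda>(p, k). vt p k) (P \<times> {..<3})"
  obtains Q M where "Q \<subseteq> P" "p0 \<in> Q" "pairwise disjnt M" "M \<subseteq> E"
    "\<Union>M = (\<Union>p\<in>Q. vt p ` {..<3})"
proof -
  obtain F where F: "1 / (4 * 2 ^ (2 ^ card L)) * real (card P) ^ m
      \<le> real (card {r\<in>T. (\<forall>v\<in>L. rich \<gamma> \<Lambda> F v) \<and> ltype r = F})"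
    using popular_type[OF small] .
  define T' where "T' = {r\<in>T. (\<forall>v\<in>L. rich \<gamma> \<Lambda> F v) \<and> ltype r = F}"
  obtain S where S: "\<forall>i<m. S i \<subseteq> P - {p0} \<and> card (S i) = Suc s" "disjoint_family_on S {..<m}"
      "(\<Pi>\<^sub>E i\<in>{..<m}. S i) \<subseteq> T'"
    using complete[of T'] F unfolding T'_def by blast
  \<comment> \<open>Parts of size \<open>Suc s\<close> are nonempty even if s is 0; this yields the
    tuple \<open>r0\<close> of type F and later fills the positions that an edge does not
    meet.\<close>
  have Sne: "S i \<noteq> {}" if "i < m" for i using S(1) that by fastforce
  hence "(\<Pi>\<^sub>E i\<in>{..<m}. S i) \<noteq> {}" by (auto simp: PiE_eq_empty_iff)
  then obtain r0 where "r0 \<in> T'" using S(3) by blast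
  hence r0: "\<forall>v\<in>L. rich \<gamma> \<Lambda> (ltype r0) v" "ltype r0 = F" by (auto simp: T'_def)
  then interpret rs: rich_system \<gamma> \<Lambda> "{m} \<times> {..<3}" F
    using rich_system_type by blast
  obtain D z where Dz: "D \<le> s" "matching_weight \<Lambda> ({m} \<times> {..<3}) F D z"
    using weight[OF rs.rich_system_axioms] by blast
  have "\<exists>A. A \<subseteq> S i \<and> card A = D" if "i < m" for i
    using obtain_subset_with_card_n[of D "S i"] S(1) Dz(1) that by (metis le_SucI)
  then obtain S0 where S0: "\<And>i. i < m \<Longrightarrow> S0 i \<subseteq> S i \<and> card (S0 i) = D" by metis
  define S' where "S' = S0(m := {p0})"
  have S'P: "S' i \<subseteq> P" if "i \<le> m" for i
  proof (cases "i = m")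
    case True
    thus ?thesis using p0 by (simp add: S'_def)
  next
    case False
    hence "i < m" using that by simp
    thus ?thesis using S0[of i] S(1) False by (simp add: S'_def) blast
  qed
  have S'disj: "S' i \<inter> S' j = {}" if "i \<le> m" "j \<le> m" "i \<noteq> j" for i j
  proof -
    have "S i \<inter> S j = {}" if "i < m" "j < m"
      using S(2) that \<open>i \<noteq> j\<close> unfolding disjoint_family_on_def by simp
    moreover have "p0 \<notin> S i" if "i < m" for i using S(1) that by blast
    ultimately show ?thesis using S0[of i] S0[of j] that
      by (cases "i = m"; cases "j = m") (auto simp: S'_def)
  qed
  define Ve where "Ve x = (\<lambda>p. vt p (snd x)) ` S' (fst x)" for x :: "nat \<times> nat"
  define Q where "Q = (\<Union>i\<le>m. S' i)"
  have QP: "Q \<subseteq> P" using S'P by (auto simp: Q_def)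
  have finL: "finite L" by (simp add: L_def)
  have inj': "vt p k = vt p' k' \<longleftrightarrow> p = p' \<and> k = k'" if "p \<in> P" "p' \<in> P" "k < 3" "k' < 3" for p p' k k'
    using inj_onD[OF inj, of "(p, k)" "(p', k')"] that by auto
  have L\<Lambda>: "L = \<Lambda> \<union> {m} \<times> {..<3}" by (auto simp: \<Lambda>_def L_def)
  have "\<exists>M. pairwise disjnt M \<and> \<Union>M = (\<Union>x\<in>L. Ve x) \<and>
    (\<forall>m\<in>M. \<exists>e\<in>F. \<exists>f. (\<forall>x\<in>e. f x \<in> Ve x) \<and> m = f ` e)"
  proof (rule blowup_matching[OF finL rs.finF])
    show "e \<subseteq> L" if "e \<in> F" for e using rs.edge[OF that] unfolding L\<Lambda> by blast
    show "finite (Ve x)" if "x \<in> L" for x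
      using S'P[of "fst x"] finP finite_subset that unfolding Ve_def L_def by fastforce
    show "disjoint_family_on Ve L"
      unfolding disjoint_family_on_def
    proof (intro ballI impI)
      fix x y assume xy: "x \<in> L" "y \<in> L" "x \<noteq> y"
      show "Ve x \<inter> Ve y = {}"
      proof (rule ccontr)
        assume "Ve x \<inter> Ve y \<noteq> {}"
        then obtain p p' where p: "p \<in> S' (fst x)" "p' \<in> S' (fst y)" "vt p (snd x) = vt p' (snd y)"
          unfolding Ve_def by blast
        have le: "fst x \<le> m" "fst y \<le> m" "snd x < 3" "snd y < 3" using xy by (auto simp: L_def)
        hence "p \<in> P" "p' \<in> P" using p S'P by blast+
        hence "p = p'" "snd x = snd y" using inj' p(3) le by blast+
        moreover from this have "fst x = fst y" using S'disj[of "fst x" "fst y"] p le by blast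
        ultimately show False using xy(3) by (simp add: prod_eq_iff)
      qed
    qed
    show "(\<Sum>e\<in>F. z e * of_bool (x \<in> e)) = card (Ve x)" if x: "x \<in> L" for x
    proof -
      have le: "fst x \<le> m" "snd x < 3" using x by (auto simp: L_def)
      have "inj_on (\<lambda>p. vt p (snd x)) (S' (fst x))"
        using inj' S'P[OF le(1)] le(2) by (intro inj_onI) blast
      hence "card (Ve x) = card (S' (fst x))" unfolding Ve_def by (rule card_image)
      also have "\<dots> = (if fst x = m then 1 else D)"
        using S0[of "fst x"] le by (simp add: S'_def)
      also have "\<dots> = (\<Sum>e\<in>F. z e * of_bool (x \<in> e))"
      proof (cases "fst x = m")
        case True
        hence "x \<in> {m} \<times> {..<3}" using le by (cases x) simp
        hence "(\<Sum>e\<in>F. z e * of_bool (x \<in> e)) = 1"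
          using Dz(2) unfolding matching_weight_def by blast
        thus ?thesis using True by simp
      next
        case False
        hence "x \<in> \<Lambda>" using le by (cases x) (simp add: \<Lambda>_def)
        thus ?thesis using Dz(2) False unfolding matching_weight_def by simp
      qed
      finally show ?thesis by simp
    qed
  qed
  then obtain M where M: "pairwise disjnt M" "\<Union>M = (\<Union>x\<in>L. Ve x)"
    "\<forall>m\<in>M. \<exists>e\<in>F. \<exists>f. (\<forall>x\<in>e. f x \<in> Ve x) \<and> m = f ` e"
    by (elim exE conjE)
  have "\<mu> \<in> E" if \<mu>: "\<mu> \<in> M" for \<mu>
  proof -
    obtain e f where e: "e \<in> F" and f: "\<forall>x\<in>e. f x \<in> Ve x" and \<mu>f: "\<mu> = f ` e"
      using M(3)[rule_format, OF \<mu>] by (elim bexE exE conjE)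
    have eF: "e \<subseteq> L" "inj_on fst e" using e r0(2) unfolding ltype_def by blast+
    have "\<forall>x\<in>e. \<exists>p. p \<in> S' (fst x) \<and> f x = vt p (snd x)" using f unfolding Ve_def by blast
    then obtain g where g: "\<And>x. x \<in> e \<Longrightarrow> g x \<in> S' (fst x) \<and> f x = vt (g x) (snd x)" by metis
    \<comment> \<open>A copy of e prescribes at most one triple per position, as e is injective in
      the first coordinate. Completed by arbitrary elements of the other parts, it becomes a tuple
      in the product, hence of type F, and this makes the copy an edge.\<close>
    define r where "r = restrict (\<lambda>a. if a \<in> fst ` e then g (the_inv_into e fst a) else SOME p. p \<in> S a) {..<m}"
    have rg: "r (fst x) = g x" if "x \<in> e" "fst x < m" for x
      using that the_inv_into_f_f[OF eF(2) that(1)] by (simp add: r_def)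
    have "r \<in> (\<Pi>\<^sub>E i\<in>{..<m}. S i)"
      unfolding r_def
    proof (rule restrict_PiE_iff[THEN iffD2], rule ballI)
      fix a assume "a \<in> {..<m}"
      hence a: "a < m" by simp
      show "(if a \<in> fst ` e then g (the_inv_into e fst a) else SOME p. p \<in> S a) \<in> S a"
      proof (cases "a \<in> fst ` e")
        case True
        then obtain x where x: "x \<in> e" "a = fst x" by blast
        have "g x \<in> S' a" using g[OF x(1)] x(2) by simp
        hence "g x \<in> S a" using S0[OF a] a by (auto simp: S'_def)
        thus ?thesis using True x the_inv_into_f_f[OF eF(2) x(1)] by simp
      next
        case False
        thus ?thesis using Sne[OF a] by (simp add: some_in_eq)
      qed
    qed
    hence "ltype r = F" using S(3) unfolding T'_def by blast
    hence "vert r ` e \<in> E" using e unfolding ltype_def by blast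
    moreover have "vert r x = f x" if x: "x \<in> e" for x
    proof (cases "fst x = m")
      case True
      hence "g x = p0" using g[OF x] by (simp add: S'_def)
      thus ?thesis using g[OF x] True by (simp add: vert_def case_prod_beta)
    next
      case False
      hence "fst x < m" using x eF(1) by (auto simp: L_def)
      thus ?thesis using g[OF x] rg[OF x] by (simp add: vert_def case_prod_beta)
    qed
    hence "vert r ` e = \<mu>" unfolding \<mu>f by (rule image_cong[OF refl])
    ultimately show ?thesis by simp
  qed
  moreover have "(\<Union>x\<in>L. Ve x) = (\<Union>p\<in>Q. vt p ` {..<3})"
    unfolding Ve_def L_def Q_def by fastforce
  moreover have "p0 \<in> Q" unfolding Q_def by (auto simp: S'_def)
  ultimately show ?thesis using that[of Q M] QP M(1,2) by (simp add: subset_iff)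
qed

end

subsection \<open>Partitions into triples\<close>

definition triple_partition :: "'a set \<Rightarrow> 'a set set \<Rightarrow> bool" where
  "triple_partition V P \<longleftrightarrow> \<Union>P = V \<and> pairwise disjnt P \<and> (\<forall>p\<in>P. card p = 3)"

lemma triple_partition_exists:
  assumes "finite V" "3 dvd card V"
  shows "\<exists>P. triple_partition V P"
  using assms
proof (induction "card V" arbitrary: V rule: less_induct)
  case less
  show ?case
  proof (cases "V = {}")
    case True
    thus ?thesis by (intro exI[of _ "{}"]) (simp add: triple_partition_def)
  next
    case False
    hence "0 < card V" using less.prems by (simp add: card_gt_0_iff)
    hence "3 \<le> card V" using less.prems by (auto dest: dvd_imp_le)
    then obtain p where p: "p \<subseteq> V" "card p = 3" "finite p"
      by (meson obtain_subset_with_card_n)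
    have c: "card (V - p) = card V - 3" using p less.prems by (simp add: card_Diff_subset)
    have "\<exists>P. triple_partition (V - p) P"
      using less.prems c \<open>3 \<le> card V\<close> by (intro less.hyps) (auto simp: dvd_diff_nat)
    then obtain P where P: "\<Union>P = V - p" "pairwise disjnt P" "\<forall>p\<in>P. card p = 3"
      unfolding triple_partition_def by blast
    have "triple_partition V (insert p P)" unfolding triple_partition_def
    proof (intro conjI)
      show "\<Union>(insert p P) = V" using P(1) p(1) by auto
      have "disjnt p q" if "q \<in> P" for q using P(1) that unfolding disjnt_def by blast
      thus "pairwise disjnt (insert p P)"
        using P(2) by (auto simp: pairwise_insert disjnt_sym)
    qed (use P p in auto)
    thus ?thesis by blast
  qed
qed

text \<open>Counting vertices gives \<open>card M = card Q\<close>. Replacing Q by M therefore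
  trades fewer than \<open>card Q\<close> edges, as \<open>p0\<close> is not one, for
  \<open>card Q\<close> edges.\<close>

lemma triple_partition_exchange:
  assumes V: "finite V" and P: "triple_partition V P" and Q: "Q \<subseteq> P" "p0 \<in> Q" "p0 \<notin> E"
    and M: "pairwise disjnt M" "M \<subseteq> E" "\<Union>M = \<Union>Q" and E: "\<And>e. e \<in> E \<Longrightarrow> card e = 3"
  shows "\<exists>P'. triple_partition V P' \<and> card (P \<inter> E) < card (P' \<inter> E)"
proof -
  have PV: "\<Union>P = V" and dP: "pairwise disjnt P" and P3: "\<And>p. p \<in> P \<Longrightarrow> card p = 3"
    using P unfolding triple_partition_def by auto
  have finP: "finite P" using PV V by (metis finite_UnionD)
  have finUQ: "finite (\<Union>Q)" using V PV Q(1) finite_subset[of "\<Union>Q" V] by blast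
  have finM: "finite M" using finUQ M(3) by (metis finite_UnionD)
  have finQ: "finite Q" using Q finP finite_subset by blast
  have M3: "card e = 3" if "e \<in> M" for e using that M(2) E by blast
  have dQ: "pairwise disjnt Q" using dP Q(1) pairwise_mono by blast
  have fin3: "finite e" if "card e = 3" for e :: "'a set" using that card_ge_0_finite[of e] by simp
  have "card (\<Union>M) = 3 * card M"
    using M(1) M3 fin3 by (subst card_Union_disjoint) (simp_all add: pairwise_def disjnt_def)
  moreover have "card (\<Union>Q) = 3 * card Q"
    using dQ P3 fin3 Q(1) by (subst card_Union_disjoint) (auto simp: subset_iff)
  ultimately have cMQ: "card M = card Q" using M(3) by simp
  have out: "disjnt p (\<Union>Q)" if "p \<in> P - Q" for p
  proof -
    have "disjnt p q" if "q \<in> Q" for q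
      using that \<open>p \<in> P - Q\<close> Q(1) by (intro pairwiseD[OF dP]) auto
    thus ?thesis by (auto simp: disjnt_def)
  qed
  have outM: "disjnt p e" if "p \<in> P - Q" "e \<in> M" for p e
    using out[OF that(1)] that(2) M(3) unfolding disjnt_def by blast
  define P' where "P' = (P - Q) \<union> M"
  have "triple_partition V P'" unfolding triple_partition_def
  proof (intro conjI)
    have "\<Union>P' = \<Union>(P - Q) \<union> \<Union>Q" unfolding P'_def M(3)[symmetric] by blast
    also have "\<dots> = \<Union>P" using Q(1) by blast
    finally show "\<Union>P' = V" using PV by simp
    show "pairwise disjnt P'" unfolding P'_def
    proof (rule pairwiseI)
      fix x y assume "x \<in> P - Q \<union> M" "y \<in> P - Q \<union> M" "x \<noteq> y"
      then consider "x \<in> P" "y \<in> P" | "x \<in> M" "y \<in> M" | "x \<in> P - Q" "y \<in> M" | "x \<in> M" "y \<in> P - Q"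
        by blast
      thus "disjnt x y"
      proof cases
        case 1
        thus ?thesis using pairwiseD[OF dP] \<open>x \<noteq> y\<close> by blast
      next
        case 2
        thus ?thesis using pairwiseD[OF M(1)] \<open>x \<noteq> y\<close> by blast
      next
        case 3
        thus ?thesis by (rule outM)
      next
        case 4
        thus ?thesis using outM[of y x] by (simp add: disjnt_sym)
      qed
    qed
    show "\<forall>p\<in>P'. card p = 3" using P3 M3 by (auto simp: P'_def)
  qed
  moreover have "card (P \<inter> E) < card (P' \<inter> E)"
  proof -
    have "P \<inter> E = ((P - Q) \<inter> E) \<union> (Q \<inter> E)" using Q(1) by blast
    hence "card (P \<inter> E) \<le> card ((P - Q) \<inter> E) + card (Q \<inter> E)" by (simp add: card_Un_le)
    also have "card (Q \<inter> E) < card Q"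
      using Q finQ by (intro psubset_card_mono) auto
    hence "card ((P - Q) \<inter> E) + card (Q \<inter> E) < card ((P - Q) \<inter> E) + card M" using cMQ by simp
    also have "\<dots> = card (((P - Q) \<inter> E) \<union> M)"
    proof (rule card_Un_disjoint[symmetric])
      have "e \<notin> P - Q" if "e \<in> M" for e
      proof
        assume "e \<in> P - Q"
        hence "disjnt e e" using outM that by blast
        hence "e = {}" by (simp add: disjnt_def)
        thus False using M3[OF that] by simp
      qed
      thus "(P - Q) \<inter> E \<inter> M = {}" by blast
    qed (use finP finM in auto)
    also have "((P - Q) \<inter> E) \<union> M = P' \<inter> E" using M(2) by (auto simp: P'_def)
    finally show ?thesis .
  qed
  ultimately show ?thesis by blast
qed

section \<open>Choice of constants and conclusion\<close>

lemma more_edges: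
  assumes \<gamma>: "0 < \<gamma>" "\<gamma> < 1/3"
  shows "\<exists>n\<^sub>0. \<forall>(H :: 'a::linorder set \<times> 'a set set) P. three_graph H \<and> finite (fst H) \<and>
    n\<^sub>0 \<le> card (fst H) \<and>
    (\<forall>v\<in>fst H. (2/3 + \<gamma>) * real (card (fst H)) < graph_spectral_radius (link_graph H v)) \<and>
    triple_partition (fst H) P \<and> \<not> P \<subseteq> snd H \<longrightarrow>
    (\<exists>P'. triple_partition (fst H) P' \<and> card (P \<inter> snd H) < card (P' \<inter> snd H))"
proof -
  \<comment> \<open>The constants are chosen in the order m, s, \<delta>, n0, each depending only on
    \<gamma> and its predecessors. The failure probability is polynomial times exponentially small
    in m.\<close>
  define c where "c = (\<gamma>/100)\<^sup>2 / 50"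
  have "c > 0" using \<gamma> by (simp add: c_def)
  have "((\<lambda>m. (3 * real m + 3)\<^sup>2 * exp (- (c * real m))) \<longlongrightarrow> 0) at_top"
    using \<open>c > 0\<close> by real_asymp
  hence "eventually (\<lambda>m. (3 * real m + 3)\<^sup>2 * exp (- (c * real m)) < 1/2) at_top"
    by (rule order_tendstoD) simp
  moreover have "eventually (\<lambda>m. 5 / (\<gamma>/100) \<le> real m) at_top"
    by real_asymp
  ultimately have "eventually (\<lambda>m. (3 * real m + 3)\<^sup>2 * exp (- (c * real m)) < 1/2 \<and> 5 / (\<gamma>/100) \<le> real m) at_top"
    by (rule eventually_conj)
  then obtain N where "\<forall>m\<ge>N. (3 * real m + 3)\<^sup>2 * exp (- (c * real m)) < 1/2 \<and> 5 / (\<gamma>/100) \<le> real m"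
    unfolding eventually_at_top_linorder by (elim exE)
  then obtain m :: nat where m': "(3 * real m + 3)\<^sup>2 * exp (- (c * real m)) < 1/2" "5 / (\<gamma>/100) \<le> real m"
    by (meson order_refl)
  have m: "5 \<le> \<gamma>/100 * real m" using m'(2) \<gamma> by (simp add: field_simps)
  have small: "(3 * real m + 3)\<^sup>2 * exp (- ((\<gamma>/100)\<^sup>2 * real m / 50)) \<le> 1/2"
    using m'(1) by (simp add: c_def)
  obtain s where s: "\<And>F. rich_system \<gamma> ({..<m} \<times> {..<3::nat}) ({m} \<times> {..<3}) F \<Longrightarrow>
      \<exists>D z. D \<le> s \<and> matching_weight ({..<m} \<times> {..<3}) ({m} \<times> {..<3}) F D z"
    using bounded_matching_weight[of "{..<m} \<times> {..<3::nat}" "{m} \<times> {..<3}" \<gamma>] by auto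
  define \<delta> where "\<delta> = 1 / (4 * (2::real) ^ (2 ^ card ({..m} \<times> {..<3::nat})))"
  have "0 < \<delta>" by (simp add: \<delta>_def)
  \<comment> \<open>The forbidden set will be \<open>{p0}\<close>, hence the bound 1: the triple
    under repair must not occur in a part as well.\<close>
  obtain n0 where n0: "\<forall>(P :: 'a set set) X E. finite P \<and> n0 \<le> card P \<and> finite X \<and> card X \<le> 1 \<and>
      E \<subseteq> (\<Pi>\<^sub>E i\<in>{..<m}. P) \<and> \<delta> * real (card P) ^ m \<le> real (card E) \<longrightarrow>
      (\<exists>S. (\<forall>i<m. S i \<subseteq> P - X \<and> card (S i) = Suc s) \<and> disjoint_family_on S {..<m} \<and>
        (\<Pi>\<^sub>E i\<in>{..<m}. S i) \<subseteq> E)"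
    using erdos_complete_multipartite[OF \<open>0 < \<delta>\<close>, of 1 m "Suc s"] by (elim exE)
  \<comment> \<open>The factor 3 converts from triples to vertices; with at least 2 vertices every
    link has a vertex.\<close>
  show ?thesis
  proof (intro exI[of _ "max 2 (3 * n0)"] allI impI, elim conjE)
    fix H :: "'a set \<times> 'a set set" and P
    assume H: "three_graph H" "finite (fst H)" "max 2 (3 * n0) \<le> card (fst H)"
      and \<rho>: "\<forall>v\<in>fst H. (2/3 + \<gamma>) * real (card (fst H)) < graph_spectral_radius (link_graph H v)"
      and P: "triple_partition (fst H) P" "\<not> P \<subseteq> snd H"
    define V where "V = fst H"
    define E where "E = snd H"
    have finV: "finite V" using H by (simp add: V_def)
    have PV: "\<Union>P = V" and dP: "pairwise disjnt P" and P3: "\<And>p. p \<in> P \<Longrightarrow> card p = 3"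
      using P unfolding triple_partition_def V_def by auto
    have finP: "finite P" using PV finV by (metis finite_UnionD)
    have finp: "finite p" if "p \<in> P" for p using P3[OF that] card_ge_0_finite[of p] by simp
    have cardV: "card V = 3 * card P"
      unfolding PV[symmetric] using dP P3 finp by (subst card_Union_disjoint) auto
    obtain p0 where p0E: "p0 \<in> P" "p0 \<notin> E" using P(2) by (auto simp: E_def)
    have "\<forall>x\<in>V. \<exists>\<phi>. (\<forall>y\<in>V. 0 \<le> \<phi> y \<and> \<phi> y \<le> 3/2) \<and> sum \<phi> V = real (card V) \<and>
        (\<forall>y\<in>V. (2/3 + \<gamma>) * real (card V) * \<phi> y \<le> sum \<phi> {z\<in>V. {x, y, z} \<in> E})"
    proof
      fix x assume x: "x \<in> V"
      obtain \<phi> :: "'a \<Rightarrow> real" where \<phi>: "\<And>y. y \<in> V \<Longrightarrow> 0 \<le> \<phi> y" "\<And>y. y \<in> V \<Longrightarrow> \<phi> y \<le> 3/2"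
        "sum \<phi> V = real (card V)"
        "\<And>y. y \<in> V \<Longrightarrow> (2/3 + \<gamma>) * real (card V) * \<phi> y \<le> sum \<phi> {z\<in>V. {x, y, z} \<in> E}"
      proof (rule link_eigenvector[OF H(1,2), of x "2/3 + \<gamma>", folded V_def E_def])
        show "(2/3 + \<gamma>) * real (card V) < graph_spectral_radius (link_graph H x)"
          using \<rho> x by (simp add: V_def)
      qed (use x H(3) \<gamma> in \<open>auto simp: V_def\<close>)
      thus "\<exists>\<phi>. (\<forall>y\<in>V. 0 \<le> \<phi> y \<and> \<phi> y \<le> 3/2) \<and> sum \<phi> V = real (card V) \<and>
        (\<forall>y\<in>V. (2/3 + \<gamma>) * real (card V) * \<phi> y \<le> sum \<phi> {z\<in>V. {x, y, z} \<in> E})"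
        by (intro exI[of _ \<phi>]) simp
    qed
    then obtain \<phi> where \<phi>: "\<forall>x\<in>V. (\<forall>y\<in>V. 0 \<le> \<phi> x y \<and> \<phi> x y \<le> 3/2) \<and> sum (\<phi> x) V = real (card V) \<and>
        (\<forall>y\<in>V. (2/3 + \<gamma>) * real (card V) * \<phi> x y \<le> sum (\<phi> x) {z\<in>V. {x, y, z} \<in> E})"
      by (rule bchoice[THEN exE])
    define vt where "vt p k = sorted_list_of_set p ! k" for p :: "'a set" and k
    have bij: "bij_betw (vt p) {..<3} p" if "p \<in> P" for p
      unfolding vt_def using finp[OF that] P3[OF that] by (intro bij_betw_nth) auto
    have vt_p: "vt p k \<in> p" if "p \<in> P" "k < 3" for p k
      using bij_betwE[OF bij[OF that(1)]] that(2) by blast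
    have img: "vt p ` {..<3} = p" if "p \<in> P" for p
      using bij[OF that] by (simp add: bij_betw_def)
    interpret triple_sampling P vt V E \<phi> \<gamma> m p0
    proof
      show "vt p k \<in> V" if "p \<in> P" "k < 3" for p k using vt_p[OF that] that(1) PV by blast
      show "(\<Sum>p\<in>P. \<Sum>k<3. h (vt p k)) = sum h V" for h :: "'a \<Rightarrow> real"
      proof -
        have "(\<Sum>p\<in>P. \<Sum>k<3. h (vt p k)) = (\<Sum>p\<in>P. sum h p)"
          using bij by (intro sum.cong refl sum.reindex_bij_betw)
        also have "\<dots> = sum h V" unfolding PV[symmetric]
          using dP finp by (subst sum.Union_disjoint) (auto simp: pairwise_def disjnt_def)
        finally show ?thesis .
      qed
      show "0 \<le> \<phi> x y \<and> \<phi> x y \<le> 3/2" if "x \<in> V" "y \<in> V" for x y using \<phi> that by blast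
      show "sum (\<phi> x) V = 3 * real (card P)" if "x \<in> V" for x using \<phi> that cardV by simp
      show "(2/3 + \<gamma>) * (3 * real (card P)) * \<phi> x y \<le> sum (\<phi> x) {z\<in>V. {x, y, z} \<in> E}"
        if "x \<in> V" "y \<in> V" for x y
      proof -
        have "(2/3 + \<gamma>) * real (card V) * \<phi> x y \<le> sum (\<phi> x) {z\<in>V. {x, y, z} \<in> E}"
          using \<phi> that by blast
        thus ?thesis unfolding cardV by simp
      qed
    qed (use finP p0E \<gamma> m finV in auto)
    obtain Q M where QM: "Q \<subseteq> P" "p0 \<in> Q" "pairwise disjnt M" "M \<subseteq> E"
      "\<Union>M = (\<Union>p\<in>Q. vt p ` {..<3})"
    proof (rule augmentation[OF small])
      show "\<exists>D z. D \<le> s \<and> matching_weight \<Lambda> ({m} \<times> {..<3}) F D z"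
        if "rich_system \<gamma> \<Lambda> ({m} \<times> {..<3}) F" for F
        using s that unfolding \<Lambda>_def .
      show "\<exists>S. (\<forall>i<m. S i \<subseteq> P - {p0} \<and> card (S i) = Suc s) \<and> disjoint_family_on S {..<m} \<and>
        (\<Pi>\<^sub>E i\<in>{..<m}. S i) \<subseteq> T'"
        if T': "T' \<subseteq> T" "1 / (4 * 2 ^ (2 ^ card L)) * real (card P) ^ m \<le> real (card T')" for T'
      proof (rule n0[rule_format], intro conjI)
        show "n0 \<le> card P" using H(3) cardV by (simp add: V_def)
        show "\<delta> * real (card P) ^ m \<le> real (card T')" using T'(2) by (simp add: \<delta>_def L_def)
      qed (use finP T'(1) in \<open>auto simp: T_def\<close>)
      show "inj_on (\<lambda>(p, k). vt p k) (P \<times> {..<3})"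
      proof (rule inj_onI, clarify)
        fix p k q l assume *: "p \<in> P" "q \<in> P" "k < (3::nat)" "l < (3::nat)" "vt p k = vt q l"
        have "vt p k \<in> p \<inter> q" using vt_p[of p k] vt_p[of q l] * by auto
        hence "p = q" using dP * unfolding pairwise_def disjnt_def by blast
        moreover from this have "k = l" using bij[of p] * by (auto simp: bij_betw_def inj_on_def)
        ultimately show "p = q \<and> k = l" by blast
      qed
    qed (rule that)
    have "(\<Union>p\<in>Q. vt p ` {..<3}) = \<Union>Q" using img QM(1) by (auto simp: subset_iff)
    hence MQ: "\<Union>M = \<Union>Q" using QM(5) by simp
    have E3: "card e = 3" if "e \<in> E" for e
      using H(1) that unfolding three_graph_def E_def by blast
    have "\<exists>P'. triple_partition V P' \<and> card (P \<inter> E) < card (P' \<inter> E)"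
      using triple_partition_exchange[OF finV P(1)[folded V_def] QM(1,2) p0E(2) QM(3,4) MQ E3] .
    thus "\<exists>P'. triple_partition (fst H) P' \<and> card (P \<inter> snd H) < card (P' \<inter> snd H)"
      by (simp add: V_def E_def)
  qed
qed

theorem theorem1p1:
  shows "\<exists>\<gamma>\<^sub>0::real. \<gamma>\<^sub>0 > 0 \<and>
    (\<forall>\<gamma>::real. 0 < \<gamma> \<and> \<gamma> < \<gamma>\<^sub>0 \<longrightarrow>
      (\<exists>n\<^sub>0::nat. \<forall>n::nat. n \<ge> n\<^sub>0 \<and> n mod 3 = 0 \<longrightarrow>
        (\<forall>H :: nat set \<times> nat set set.
          three_graph H \<and> fst H = {1..n} \<and>
          (\<forall>v\<in>fst H. graph_spectral_radius (link_graph H v) > (2 / 3 + \<gamma>) * real n) \<longrightarrow>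
          (\<exists>M. perfect_matching H M))))"
  proof (rule exI[of _ "1/3"], intro conjI allI impI)
  fix \<gamma> :: real
  \<comment> \<open>From 1/3 on the spectral hypothesis fails for large n, since a graph on n - 1
    vertices has spectral radius below n. Below it, \<open>2/3 + \<gamma> < 1\<close>, which the
    estimates use.\<close>
  assume "0 < \<gamma> \<and> \<gamma> < 1/3"
  hence \<gamma>: "0 < \<gamma>" "\<gamma> < 1/3" by simp_all
  obtain n0 where n0: "\<forall>(H :: nat set \<times> nat set set) P. three_graph H \<and> finite (fst H) \<and>
    n0 \<le> card (fst H) \<and>
    (\<forall>v\<in>fst H. (2/3 + \<gamma>) * real (card (fst H)) < graph_spectral_radius (link_graph H v)) \<and>
    triple_partition (fst H) P \<and> \<not> P \<subseteq> snd H \<longrightarrow>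
    (\<exists>P'. triple_partition (fst H) P' \<and> card (P \<inter> snd H) < card (P' \<inter> snd H))"
    using more_edges[OF \<gamma>] by (elim exE)
  show "\<exists>n\<^sub>0::nat. \<forall>n::nat. n \<ge> n\<^sub>0 \<and> n mod 3 = 0 \<longrightarrow>
        (\<forall>H :: nat set \<times> nat set set.
          three_graph H \<and> fst H = {1..n} \<and>
          (\<forall>v\<in>fst H. graph_spectral_radius (link_graph H v) > (2 / 3 + \<gamma>) * real n) \<longrightarrow>
          (\<exists>M. perfect_matching H M))"
  proof (intro exI[of _ n0] allI impI, elim conjE)
    fix n :: nat and H :: "nat set \<times> nat set set"
    assume n: "n0 \<le> n" "n mod 3 = 0" and H: "three_graph H" "fst H = {1..n}"
      and \<rho>: "\<forall>v\<in>fst H. (2 / 3 + \<gamma>) * real n < graph_spectral_radius (link_graph H v)"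
    have fin: "finite (fst H)" and card: "card (fst H) = n" using H(2) by simp_all
    obtain P0 where P0: "triple_partition (fst H) P0"
      using triple_partition_exists[OF fin] n(2) card by auto
    have "\<forall>P. triple_partition (fst H) P \<longrightarrow> card (P \<inter> snd H) < Suc (card (Pow (fst H)))"
    proof (intro allI impI)
      fix P assume "triple_partition (fst H) P"
      hence "P \<inter> snd H \<subseteq> Pow (fst H)" unfolding triple_partition_def by blast
      thus "card (P \<inter> snd H) < Suc (card (Pow (fst H)))"
        using fin by (simp add: card_mono less_Suc_eq_le del: card_Pow)
    qed
    then obtain P where P: "triple_partition (fst H) P"
      and max: "\<forall>P'. triple_partition (fst H) P' \<longrightarrow> card (P' \<inter> snd H) \<le> card (P \<inter> snd H)"
      using ex_has_greatest_nat[of "triple_partition (fst H)" P0 "\<lambda>P. card (P \<inter> snd H)"] P0 by blast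
    have "P \<subseteq> snd H"
    proof (rule ccontr)
      assume "\<not> P \<subseteq> snd H"
      then obtain P' where "triple_partition (fst H) P'" "card (P \<inter> snd H) < card (P' \<inter> snd H)"
        using n0[rule_format, of H P] H(1) fin card n(1) \<rho> P by auto
      thus False using max by fastforce
    qed
    hence "perfect_matching H P"
      using P unfolding triple_partition_def perfect_matching_def matching_def by blast
    thus "\<exists>M. perfect_matching H M" by blast
  qed
qed simp

end
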